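(* Let $\alpha>0$, $1\le p<\infty$ and $1\le q\le\infty$. If $\mu$ is a compactly supported finite measure on $\mathbb{R}^d$ with $\mu\in \mathrm{SBE}^{\alpha,p}_q$, then $\mu$ belongs to the Besov space $B^{\alpha}_{q,\infty}(\mathbb{R}^d)$. More precisely, $$\|\mu\|_{B^{\alpha}_{q,\infty}}\lesssim \|\mu\|_{\mathrm{SBE}^{\alpha,p}_q},$$ where the implicit constant does not depend on $\mu$.
   Context: The symbol $\lesssim$ denotes an inequality up to numerical factors that do not depend on the main quantities of the problem (here, in particular, not on $\mu$). $\mathbb{R}^+=(0,\infty)$. For a finite measure $\mu$ on $\mathbb{R}^d$ set $F_\mu(r,y)=\mu(\{x\in\mathbb{R}^d:|x-y|\le r\})$, $r\in\mathbb{R}^+$, $y\in\mathbb{R}^d$. For a function $F$ of $r$ define recursively $\Delta_0F(r)=F(r)-F(r/2)$, $\Delta_{k+1}F(r)=\Delta_kF(r)-2^{k+1}\Delta_kF(r/2)$. For $\alpha>0$, $1\le p,q\le\infty$ and $k=\lceil\alpha+d-1\rceil$, set $$\|\mu\|_{\mathrm{SBE}^{\alpha,p}_q}=\big\|r^{-\alpha-d}(\Delta_k)_rF_\mu(r,y)\big\|_{L^q_yL^p_r(\mathbb{R}^d\times\mathbb{R}^+,\,dy\otimes\frac{dr}{r})},$$ where $(\Delta_k)_r$ acts in the variable $r$, the $L^p$ norm in $r$ (w.r.t. $dr/r$) is taken first and then the $L^q$ norm in $y$. A compactly supported finite measure $\mu$ is in $\mathrm{SBE}^{\alpha,p}_q$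 if this quantity is finite. $B^s_{p,q}=B^s_{p,q}(\mathbb{R}^d)$ are the standard Besov spaces on $\mathbb{R}^d$.
   Formalization: The inequality with constant independent of μ fails by scaling for the inhomogeneous norm (low-frequency part); it is proved for the homogeneous Besov norm, and for the full norm with a constant depending on the radius of a ball carrying μ. Membership is as stated. *)

theory Defs
  imports "HOL-Analysis.Analysis" "HOL-Probability.Essential_Supremum"
begin

text \<open>
  Throughout, \<open>'a::euclidean_space\<close> plays the role of \<open>\<real>\<^sup>d\<close> with \<open>d = DIM('a)\<close>.
\<close>

section \<open>Lebesgue norms of nonnegative extended functions\<close>

text \<open>Powers with a positive real exponent; the value at \<open>\<infinity>\<close> is \<open>\<infinity>\<close>.\<close>

definition epow :: "ennreal \<Rightarrow> real \<Rightarrow> ennreal" where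
  "epow x a = (if x = \<infinity> then \<infinity> else ennreal (enn2real x powr a))"

text \<open>Meant for exponents \<open>1 \<le> p \<le> \<infinity>\<close>.\<close>

definition Lp_norm :: "'b measure \<Rightarrow> ennreal \<Rightarrow> ('b \<Rightarrow> ennreal) \<Rightarrow> ennreal" where
  "Lp_norm M p f =
     (if p = \<infinity> then esssup M f
      else epow (\<integral>\<^sup>+ x. epow (f x) (enn2real p) \<partial>M) (1 / enn2real p))"

section \<open>The small ball norm\<close>

definition ball_mass :: "'a::euclidean_space measure \<Rightarrow> real \<Rightarrow> 'a \<Rightarrow> real" where
  "ball_mass \<mu> r y = measure \<mu> {x. norm (x - y) \<le> r}"

primrec dyadic_diff :: "nat \<Rightarrow> (real \<Rightarrow> real) \<Rightarrow> real \<Rightarrow> real" where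
  "dyadic_diff 0 F r = F r - F (r / 2)"
| "dyadic_diff (Suc k) F r = dyadic_diff k F r - 2 ^ (k + 1) * dyadic_diff k F (r / 2)"

text \<open>The measure \<open>dr / r\<close> on \<open>(0, \<infinity>)\<close>, as a measure on \<open>\<real>\<close> that vanishes on \<open>(-\<infinity>, 0]\<close>.\<close>

definition dr_over_r :: "real measure" where
  "dr_over_r = density lborel (\<lambda>r. if 0 < r then ennreal (1 / r) else 0)"

definition sbe_norm ::
    "real \<Rightarrow> ennreal \<Rightarrow> ennreal \<Rightarrow> 'a::euclidean_space measure \<Rightarrow> ennreal" where
  "sbe_norm \<alpha> p q \<mu> =
     (let d = real DIM('a); k = nat \<lceil>\<alpha> + d - 1\<rceil> in
      Lp_norm lborel q (\<lambda>y. Lp_norm dr_over_r p (\<lambda>r.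
        ennreal \<bar>r powr (- \<alpha> - d) * dyadic_diff k (\<lambda>s. ball_mass \<mu> s y) r\<bar>)))"

text \<open>Finite (nonnegative) Borel measures with compact support.\<close>

definition compact_finite_measure :: "'a::euclidean_space measure \<Rightarrow> bool" where
  "compact_finite_measure \<mu> \<longleftrightarrow>
     sets \<mu> = sets borel \<and> finite_measure \<mu> \<and> (\<exists>K. compact K \<and> emeasure \<mu> (- K) = 0)"

definition SBE :: "real \<Rightarrow> ennreal \<Rightarrow> ennreal \<Rightarrow> 'a::euclidean_space measure set" where
  "SBE \<alpha> p q = {\<mu>. compact_finite_measure \<mu> \<and> sbe_norm \<alpha> p q \<mu> < \<infinity>}"

section \<open>Schwartz functions and tempered distributions\<close>

text \<open>Iterated partial derivatives along a list of directions.\<close>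

primrec iter_deriv ::
    "'a::euclidean_space list \<Rightarrow> ('a \<Rightarrow> 'b::real_normed_vector) \<Rightarrow> 'a \<Rightarrow> 'b" where
  "iter_deriv [] f = f"
| "iter_deriv (v # vs) f = (\<lambda>x. frechet_derivative (iter_deriv vs f) (at x) v)"

definition smooth :: "('a::euclidean_space \<Rightarrow> 'b::real_normed_vector) \<Rightarrow> bool" where
  "smooth f \<longleftrightarrow> (\<forall>vs. set vs \<subseteq> Basis \<longrightarrow> (\<forall>x. iter_deriv vs f differentiable (at x)))"

definition schwartz :: "('a::euclidean_space \<Rightarrow> complex) \<Rightarrow> bool" where
  "schwartz f \<longleftrightarrow> smooth f \<and>
     (\<forall>N vs. set vs \<subseteq> Basis \<longrightarrow>
        bounded (range (\<lambda>x. (1 + norm x) ^ N *\<^sub>R iter_deriv vs f x)))"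

definition schwartz_seminorm :: "nat \<Rightarrow> ('a::euclidean_space \<Rightarrow> complex) \<Rightarrow> real" where
  "schwartz_seminorm N f =
     (\<Sum>vs\<in>{vs. set vs \<subseteq> Basis \<and> length vs \<le> N}.
        SUP x. (1 + norm x) ^ N * norm (iter_deriv vs f x))"

text \<open>A distribution is a functional on all functions, of which only the values on Schwartz
  functions are ever relevant.\<close>

definition tempered_distribution :: "(('a::euclidean_space \<Rightarrow> complex) \<Rightarrow> complex) \<Rightarrow> bool" where
  "tempered_distribution u \<longleftrightarrow>
     (\<forall>f g. schwartz f \<longrightarrow> schwartz g \<longrightarrow> u (\<lambda>x. f x + g x) = u f + u g) \<and>
     (\<forall>c f. schwartz f \<longrightarrow> u (\<lambda>x. c * f x) = c * u f) \<and>
     (\<exists>C N. \<forall>f. schwartz f \<longrightarrow> norm (u f) \<le> C * schwartz_seminorm N f)"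

definition distr_of_measure :: "'a::euclidean_space measure \<Rightarrow> ('a \<Rightarrow> complex) \<Rightarrow> complex" where
  "distr_of_measure \<mu> f = (\<integral>x. f x \<partial>\<mu>)"

section \<open>Besov spaces\<close>

text \<open>A radial cutoff generating a smooth dyadic resolution of unity. Different cutoffs give
  the same Besov spaces with equivalent norms.\<close>

definition lp_cutoff :: "('a::euclidean_space \<Rightarrow> real) \<Rightarrow> bool" where
  "lp_cutoff \<phi> \<longleftrightarrow> smooth \<phi> \<and>
     (\<forall>\<xi> \<eta>. norm \<xi> = norm \<eta> \<longrightarrow> \<phi> \<xi> = \<phi> \<eta>) \<and>
     (\<forall>\<xi>. norm \<xi> \<le> 1 \<longrightarrow> \<phi> \<xi> = 1) \<and> (\<forall>\<xi>. 2 \<le> norm \<xi> \<longrightarrow> \<phi> \<xi> = 0)"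

text \<open>The symbol \<open>\<phi>(2\<^bsup>-j\<^esup> \<xi>) - \<phi>(2\<^bsup>-j+1\<^esup> \<xi>)\<close>, supported in
  \<open>2\<^bsup>j-1\<^esup> \<le> |\<xi>| \<le> 2\<^bsup>j+1\<^esup>\<close>.\<close>

definition dyadic_symbol :: "('a::euclidean_space \<Rightarrow> real) \<Rightarrow> int \<Rightarrow> 'a \<Rightarrow> real" where
  "dyadic_symbol \<phi> j \<xi> = \<phi> ((2 powi (- j)) *\<^sub>R \<xi>) - \<phi> ((2 powi (- j + 1)) *\<^sub>R \<xi>)"

definition inhom_symbol :: "('a::euclidean_space \<Rightarrow> real) \<Rightarrow> nat \<Rightarrow> 'a \<Rightarrow> real" where
  "inhom_symbol \<phi> j = (if j = 0 then \<phi> else dyadic_symbol \<phi> (int j))"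

definition inv_fourier :: "('a::euclidean_space \<Rightarrow> real) \<Rightarrow> 'a \<Rightarrow> complex" where
  "inv_fourier m x =
     (1 / (2 * pi) ^ DIM('a)) *\<^sub>R (\<integral>\<xi>. cis (x \<bullet> \<xi>) * of_real (m \<xi>) \<partial>lborel)"

text \<open>For a smooth compactly supported symbol \<open>m\<close>, the Fourier multiplier \<open>m(D)u\<close> is the
  convolution of the tempered distribution \<open>u\<close> with the Schwartz function
  \<open>inv_fourier m\<close>, and hence is a function.\<close>

definition multiplier ::
    "('a::euclidean_space \<Rightarrow> real) \<Rightarrow> (('a \<Rightarrow> complex) \<Rightarrow> complex) \<Rightarrow> 'a \<Rightarrow> complex" where
  "multiplier m u x = u (\<lambda>y. inv_fourier m (x - y))"

definition besov_norm :: "('a::euclidean_space \<Rightarrow> real) \<Rightarrow> real \<Rightarrow> ennreal \<Rightarrow> ennreal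
    \<Rightarrow> (('a \<Rightarrow> complex) \<Rightarrow> complex) \<Rightarrow> ennreal" where
  "besov_norm \<phi> s p q u =
     Lp_norm (count_space (UNIV :: nat set)) q (\<lambda>j.
       ennreal (2 powr (real j * s)) *
       Lp_norm lborel p (\<lambda>x. ennreal (norm (multiplier (inhom_symbol \<phi> j) u x))))"

definition hom_besov_norm :: "('a::euclidean_space \<Rightarrow> real) \<Rightarrow> real \<Rightarrow> ennreal \<Rightarrow> ennreal
    \<Rightarrow> (('a \<Rightarrow> complex) \<Rightarrow> complex) \<Rightarrow> ennreal" where
  "hom_besov_norm \<phi> s p q u =
     Lp_norm (count_space (UNIV :: int set)) q (\<lambda>j.
       ennreal (2 powr (real_of_int j * s)) *
       Lp_norm lborel p (\<lambda>x. ennreal (norm (multiplier (dyadic_symbol \<phi> j) u x))))"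

definition besov_space :: "('a::euclidean_space \<Rightarrow> real) \<Rightarrow> real \<Rightarrow> ennreal \<Rightarrow> ennreal
    \<Rightarrow> (('a \<Rightarrow> complex) \<Rightarrow> complex) set" where
  "besov_space \<phi> s p q = {u. tempered_distribution u \<and> besov_norm \<phi> s p q u < \<infinity>}"

end

theory Submission
  imports Defs "HOL-Probability.Characteristic_Functions"
begin

text \<open>
  Write \<open>F(r, y)\<close> for the mass of the closed ball of radius \<open>r\<close> around \<open>y\<close>, and \<open>d\<close> for the
  dimension. Integrating \<open>\<Delta>\<^sub>kF(r, y)\<close> in \<open>r\<close> against the density \<open>gauss_slope s\<close>, whose tail
  integrals are Gaussians, gives the convolution of \<open>\<mu>\<close> with the dilate by \<open>s\<close> of a fixed kernel
  \<open>\<Phi> = gauss_kernel k\<close>, a combination of Gaussians of widths \<open>2\<^sup>-\<^sup>m\<close>, \<open>m \<le> k + 1\<close>. By Jensen's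
  inequality this average at \<open>y\<close> is at most a constant times \<open>s\<close> to the power \<open>\<alpha> + d\<close> times the
  \<open>L\<^sup>p\<close> norm in \<open>r\<close> that enters the small ball norm (\<open>gauss_kernel_average_le_profile\<close>).

  The dyadic blocks are recovered from these averages by division on the Fourier side. The Fourier
  transform \<open>gauss_symbol k\<close> of \<open>\<Phi>\<close> is again a combination of Gaussians, of which the slowest
  decaying one has a nonzero coefficient and dominates at infinity. Hence for a large
  \<open>\<sigma>\<close> the function \<open>gauss_symbol k (\<sigma> \<xi>)\<close> has no zero with \<open>\<bar>\<xi>\<bar> > 1/4\<close>. The symbol
  \<open>\<psi>(\<xi>) = \<phi>(\<xi>) - \<phi>(2\<xi>)\<close> vanishes for \<open>\<bar>\<xi>\<bar> \<le> 1/2\<close>, so it is the product of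
  \<open>gauss_symbol k (\<sigma> \<xi>)\<close> with a smooth compactly supported function \<open>m\<close>
  (\<open>dyadic_block_factorization\<close>). The inverse Fourier transform \<open>L\<close> of \<open>m\<close> is integrable, and the
  block of frequency \<open>t = 2\<^sup>j\<close> is the convolution of the average at scale \<open>s = \<sigma>/t\<close> with the
  dilate of \<open>L\<close> by \<open>1/t\<close> (\<open>dyadic_block_eq_convolution\<close>). Young's inequality then bounds all the
  weighted blocks by the small ball norm, uniformly in \<open>j\<close> (\<open>dyadic_block_bound\<close>).

  Division is impossible at frequency zero, where \<open>gauss_symbol k\<close> vanishes because \<open>\<alpha> > 0\<close>
  forces \<open>d \<le> k\<close>. The low frequency block is instead controlled by the total mass \<open>M\<close> of \<open>\<mu>\<close>
  (\<open>low_frequency_bound\<close>), and \<open>M\<close> is visible in the small ball norm once the support has bounded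
  size: if the support lies in the ball of radius \<open>R\<close> around \<open>c\<close>, if \<open>5R \<le> \<bar>y - c\<bar> \<le> 6R\<close>, and if
  \<open>7R/2 \<le> r/2\<^sup>k\<^sup>+\<^sup>1 < 4R\<close>, then the ball of radius \<open>r/2\<^sup>m\<close> around \<open>y\<close> contains the support for
  \<open>m \<le> k\<close> and misses it for \<open>m = k + 1\<close>, so that \<open>\<bar>\<Delta>\<^sub>kF(r, y)\<bar>\<close> is a nonzero constant times
  \<open>M\<close> (\<open>total_mass_le_sbe_norm\<close>).
\<close>

section \<open>Functions of class \<open>C\<^sup>n\<close> on open sets\<close>

text \<open>
  Continuity of the iterated partial derivatives is demanded at the last level only; on open sets
  it follows at the earlier levels from differentiability. Working relative to a set allows
  quotients whose denominator vanishes elsewhere.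
\<close>

primrec Cn_on :: "nat \<Rightarrow> 'a::euclidean_space set \<Rightarrow> ('a \<Rightarrow> real) \<Rightarrow> bool" where
  "Cn_on 0 S f \<longleftrightarrow> continuous_on S f"
| "Cn_on (Suc n) S f \<longleftrightarrow> (\<forall>x\<in>S. f differentiable at x) \<and>
     (\<forall>b\<in>Basis. Cn_on n S (\<lambda>x. frechet_derivative f (at x) b))"

text \<open>
  The recursion of \<open>iter_deriv\<close> differentiates on the outside; an induction on the order of
  smoothness needs the innermost derivative instead.
\<close>

lemma iter_deriv_snoc:
  "iter_deriv (vs @ [v]) f = iter_deriv vs (\<lambda>x. frechet_derivative f (at x) v)"
  by (induction vs) auto

lemma smooth_imp_Cn_on:
  fixes f :: "'a::euclidean_space \<Rightarrow> real"
  shows "smooth f \<Longrightarrow> Cn_on n UNIV f"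
proof (induction n arbitrary: f)
  case 0
  then have "\<forall>x. iter_deriv [] f differentiable (at x)"
    unfolding smooth_def by (metis empty_subsetI list.set(1))
  then show ?case
    by (auto intro!: continuous_at_imp_continuous_on differentiable_imp_continuous_within)
next
  case (Suc n)
  have "\<forall>x. iter_deriv [] f differentiable (at x)"
    using Suc.prems unfolding smooth_def by (metis empty_subsetI list.set(1))
  moreover have "smooth (\<lambda>x. frechet_derivative f (at x) b)" if "b \<in> Basis" for b
    unfolding smooth_def
  proof (intro allI impI)
    fix vs :: "'a list" and x assume "set vs \<subseteq> Basis"
    then have "set (vs @ [b]) \<subseteq> Basis" using that by auto
    then show "iter_deriv vs (\<lambda>x. frechet_derivative f (at x) b) differentiable (at x)"
      using Suc.prems unfolding smooth_def iter_deriv_snoc[symmetric] by blast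
  qed
  ultimately show ?case using Suc.IH by auto
qed

lemma Cn_on_subset: "Cn_on n S f \<Longrightarrow> T \<subseteq> S \<Longrightarrow> Cn_on n T f"
  by (induction n arbitrary: f) (auto intro: continuous_on_subset)

lemma Cn_on_Suc_imp: "Cn_on (Suc n) S f \<Longrightarrow> Cn_on n S f"
proof (induction n arbitrary: f)
  case 0
  then show ?case
    by (auto intro!: continuous_at_imp_continuous_on differentiable_imp_continuous_within)
next
  case (Suc n)
  then show ?case by (metis Cn_on.simps(2))
qed

lemma Cn_on_imp_continuous_on: "Cn_on n S f \<Longrightarrow> continuous_on S f"
  by (induction n) (auto dest: Cn_on_Suc_imp simp del: Cn_on.simps(2))

lemma frechet_derivative_cong_open:
  assumes "open S" "x \<in> S" "\<And>y. y \<in> S \<Longrightarrow> f y = g y"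
  shows "frechet_derivative f (at x) = frechet_derivative g (at x)"
proof -
  have "(f has_derivative D) (at x) \<longleftrightarrow> (g has_derivative D) (at x)" for D
    using has_derivative_transform_within_open[OF _ assms(1,2)] assms(3) by metis
  then show ?thesis by (simp add: frechet_derivative_def)
qed

lemma Cn_on_cong:
  assumes "open S" "Cn_on n S f" "\<And>y. y \<in> S \<Longrightarrow> f y = g y"
  shows "Cn_on n S g"
  using assms(2,3)
proof (induction n arbitrary: f g)
  case 0
  then show ?case by (auto cong: continuous_on_cong)
next
  case (Suc n)
  have "g differentiable at x" if "x \<in> S" for x
    using Suc.prems that assms(1) unfolding differentiable_def
    by (metis Cn_on.simps(2) differentiable_def has_derivative_transform_within_open)
  moreover have "Cn_on n S (\<lambda>x. frechet_derivative g (at x) b)" if "b \<in> Basis" for b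
  proof (rule Suc.IH)
    show "Cn_on n S (\<lambda>x. frechet_derivative f (at x) b)" using Suc.prems that by auto
    show "\<And>y. y \<in> S \<Longrightarrow> frechet_derivative f (at y) b = frechet_derivative g (at y) b"
      using frechet_derivative_cong_open[OF assms(1)] Suc.prems(2) by metis
  qed
  ultimately show ?case by simp
qed

lemma Cn_on_Un:
  assumes "open S" "open T"
  shows "Cn_on n S f \<Longrightarrow> Cn_on n T f \<Longrightarrow> Cn_on n (S \<union> T) f"
  by (induction n arbitrary: f) (auto intro: continuous_on_open_Un assms)

lemma Cn_on_SucI:
  assumes "open S" and "\<And>x. x \<in> S \<Longrightarrow> (f has_derivative D x) (at x)"
    and "\<And>b. b \<in> Basis \<Longrightarrow> Cn_on n S (\<lambda>x. D x b)"
  shows "Cn_on (Suc n) S f"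
proof -
  have "frechet_derivative f (at x) = D x" if "x \<in> S" for x
    using frechet_derivative_at[OF assms(2)[OF that]] by simp
  then have "Cn_on n S (\<lambda>x. frechet_derivative f (at x) b)" if "b \<in> Basis" for b
    using Cn_on_cong[OF assms(1) assms(3)[OF that]] by simp
  moreover have "\<forall>x\<in>S. f differentiable at x"
    using assms(2) by (auto simp: differentiable_def)
  ultimately show ?thesis by simp
qed

lemma Cn_on_SucD:
  assumes "Cn_on (Suc n) S f" "x \<in> S"
  shows "(f has_derivative frechet_derivative f (at x)) (at x)"
  using assms frechet_derivative_works by auto

lemma Cn_on_const: "Cn_on n S (\<lambda>x. c)"
  by (induction n arbitrary: c) auto

lemma Cn_on_inner: "open S \<Longrightarrow> Cn_on n S (\<lambda>x. x \<bullet> b)"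
proof (cases n)
  case (Suc m)
  assume "open S"
  then show ?thesis unfolding Suc
    by (rule Cn_on_SucI[where D = "\<lambda>_ h. h \<bullet> b"])
      (auto intro!: derivative_eq_intros Cn_on_const)
qed (auto intro!: continuous_intros)

lemma Cn_on_add: "open S \<Longrightarrow> Cn_on n S f \<Longrightarrow> Cn_on n S g \<Longrightarrow> Cn_on n S (\<lambda>x. f x + g x)"
proof (induction n arbitrary: f g)
  case (Suc n)
  show ?case
    by (rule Cn_on_SucI[OF Suc.prems(1)
          has_derivative_add[OF Cn_on_SucD[OF Suc.prems(2)] Cn_on_SucD[OF Suc.prems(3)]]])
      (use Suc in auto)
qed (auto intro!: continuous_intros)

lemma Cn_on_mult: "open S \<Longrightarrow> Cn_on n S f \<Longrightarrow> Cn_on n S g \<Longrightarrow> Cn_on n S (\<lambda>x. f x * g x)"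
proof (induction n arbitrary: f g)
  case (Suc n)
  show ?case
  proof (rule Cn_on_SucI[OF Suc.prems(1)
          has_derivative_mult[OF Cn_on_SucD[OF Suc.prems(2)] Cn_on_SucD[OF Suc.prems(3)]]])
    fix b :: 'a assume "b \<in> Basis"
    then show "Cn_on n S (\<lambda>x. f x * frechet_derivative g (at x) b + frechet_derivative f (at x) b * g x)"
      using Suc.prems by (intro Cn_on_add Suc.IH) (auto intro: Cn_on_Suc_imp)
  qed
qed (auto intro!: continuous_intros)

lemma Cn_on_diff: "open S \<Longrightarrow> Cn_on n S f \<Longrightarrow> Cn_on n S g \<Longrightarrow> Cn_on n S (\<lambda>x. f x - g x)"
  using Cn_on_add[of S n f "\<lambda>x. (-1) * g x"] Cn_on_mult[OF _ Cn_on_const, of S n g "-1"] by simp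

lemma Cn_on_sum:
  "open S \<Longrightarrow> (\<And>i. i \<in> I \<Longrightarrow> Cn_on n S (f i)) \<Longrightarrow> Cn_on n S (\<lambda>x. \<Sum>i\<in>I. f i x)"
  by (induction I rule: infinite_finite_induct) (auto intro: Cn_on_add Cn_on_const)

lemma Cn_on_inverse:
  "open S \<Longrightarrow> Cn_on n S f \<Longrightarrow> (\<And>x. x \<in> S \<Longrightarrow> f x \<noteq> 0) \<Longrightarrow> Cn_on n S (\<lambda>x. inverse (f x))"
proof (induction n arbitrary: f)
  case (Suc n)
  show ?case
  proof (rule Cn_on_SucI[OF Suc.prems(1)])
    fix x assume x: "x \<in> S"
    show "((\<lambda>x. inverse (f x)) has_derivative
        (\<lambda>h. (-1) * (inverse (f x) * frechet_derivative f (at x) h * inverse (f x)))) (at x)"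
      using Deriv.has_derivative_inverse[OF Suc.prems(3)[OF x] Cn_on_SucD[OF Suc.prems(2) x]] by simp
  next
    fix b :: 'a assume "b \<in> Basis"
    then show "Cn_on n S (\<lambda>x. (-1) * (inverse (f x) * frechet_derivative f (at x) b * inverse (f x)))"
      using Suc.prems by (intro Cn_on_mult Cn_on_const Suc.IH) (auto intro: Cn_on_Suc_imp)
  qed
qed (auto intro!: continuous_intros)

text \<open>
  Each derivative of the Gaussian is a polynomial multiple of the Gaussian itself, so the product
  rule closes the induction.
\<close>

lemma Cn_on_gaussian: "Cn_on n UNIV (\<lambda>x::'a::euclidean_space. exp (- c * (norm x)\<^sup>2))"
proof (induction n)
  case 0
  show ?case by (auto intro!: continuous_intros)
next
  case (Suc n)
  show ?case
  proof (rule Cn_on_SucI)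
    fix x :: 'a
    show "((\<lambda>x. exp (- c * (norm x)\<^sup>2)) has_derivative
        (\<lambda>h. (- 2 * c) * ((x \<bullet> h) * exp (- c * (norm x)\<^sup>2)))) (at x)"
      unfolding power2_norm_eq_inner
      by (auto intro!: derivative_eq_intros simp: inner_commute fun_eq_iff algebra_simps)
  next
    fix b :: 'a
    show "Cn_on n UNIV (\<lambda>x. (- 2 * c) * ((x \<bullet> b) * exp (- c * (norm x)\<^sup>2)))"
      by (intro Cn_on_mult Cn_on_const Cn_on_inner Suc) auto
  qed auto
qed

lemma Cn_on_scale: "Cn_on n UNIV f \<Longrightarrow> Cn_on n UNIV (\<lambda>x. f (c *\<^sub>R x))"
proof (induction n arbitrary: f)
  case 0
  then show ?case
    by (auto intro!: continuous_intros continuous_on_compose2[of UNIV f])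
next
  case (Suc n)
  show ?case
  proof (rule Cn_on_SucI)
    fix x :: 'a
    have d: "(f has_derivative frechet_derivative f (at (c *\<^sub>R x))) (at (c *\<^sub>R x))"
      using Cn_on_SucD[OF Suc.prems] by auto
    have l: "frechet_derivative f (at (c *\<^sub>R x)) (c *\<^sub>R h) = c * frechet_derivative f (at (c *\<^sub>R x)) h" for h
      using linear_cmul[OF has_derivative_linear[OF d]] by simp
    have "((\<lambda>x. c *\<^sub>R x) has_derivative (\<lambda>h. c *\<^sub>R h)) (at x)"
      by (auto intro!: derivative_eq_intros)
    from has_derivative_compose[OF this d]
    show "((\<lambda>x. f (c *\<^sub>R x)) has_derivative (\<lambda>h. c * frechet_derivative f (at (c *\<^sub>R x)) h)) (at x)"
      by (simp add: l)
  next
    fix b :: 'a assume "b \<in> Basis"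
    then show "Cn_on n UNIV (\<lambda>x. c * frechet_derivative f (at (c *\<^sub>R x)) b)"
      using Suc by (intro Cn_on_mult Cn_on_const Suc.IH[of "\<lambda>x. frechet_derivative f (at x) b"]) auto
  qed auto
qed

section \<open>Affine substitutions and Gaussian integrals\<close>

lemma borel_measurable_cis[measurable (raw)]:
  "f \<in> borel_measurable M \<Longrightarrow> (\<lambda>x. cis (f x)) \<in> borel_measurable M"
  by (rule borel_measurable_continuous_on) (auto intro!: continuous_intros)

lemma nn_integral_lborel_affine:
  fixes f :: "'a::euclidean_space \<Rightarrow> ennreal"
  assumes [measurable]: "f \<in> borel_measurable borel" and c: "c \<noteq> 0"
  shows "(\<integral>\<^sup>+x. f x \<partial>lborel) = \<bar>c\<bar> ^ DIM('a) * (\<integral>\<^sup>+x. f (t + c *\<^sub>R x) \<partial>lborel)"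
  by (subst lborel_affine[OF c, of t])
     (simp add: nn_integral_density nn_integral_distr nn_integral_cmult ennreal_power)

lemma integral_lborel_affine:
  fixes f :: "'a::euclidean_space \<Rightarrow> 'b::{banach, second_countable_topology}"
  assumes [measurable]: "f \<in> borel_measurable borel" and c: "c \<noteq> 0"
  shows "(\<integral>x. f x \<partial>lborel) = \<bar>c\<bar> ^ DIM('a) *\<^sub>R (\<integral>x. f (t + c *\<^sub>R x) \<partial>lborel)"
  by (subst lborel_affine[OF c, of t])
     (simp add: integral_density integral_distr)

lemma integrable_lborel_affine:
  fixes f :: "'a::euclidean_space \<Rightarrow> 'b::{banach, second_countable_topology}"
  assumes f: "integrable lborel f" and c: "c \<noteq> 0"
  shows "integrable lborel (\<lambda>x. f (t + c *\<^sub>R x))"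
proof -
  have [measurable]: "f \<in> borel_measurable borel" using f by auto
  have "(\<integral>\<^sup>+x. ennreal (norm (f x)) \<partial>lborel) < \<infinity>" using f by (simp add: integrable_iff_bounded)
  then show ?thesis
    using nn_integral_lborel_affine[of "\<lambda>x. ennreal (norm (f x))" c t] c
    by (auto simp: integrable_iff_bounded ennreal_mult_less_top ennreal_power)
qed

lemma nn_integral_lborel_reflect:
  fixes f :: "'a::euclidean_space \<Rightarrow> ennreal"
  assumes "f \<in> borel_measurable borel"
  shows "(\<integral>\<^sup>+y. f (x - y) \<partial>lborel) = (\<integral>\<^sup>+y. f y \<partial>lborel)"
  using nn_integral_lborel_affine[OF assms, of "-1" x] by simp

text \<open>
  This is the characteristic function of the standard normal distribution after a change of scale.
\<close>

lemma gaussian_integral_real: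
  fixes c t :: real assumes c: "0 < c"
  shows "integrable lborel (\<lambda>x. exp (- c * x\<^sup>2))"
    and "(\<integral>x. exp (- c * x\<^sup>2) *\<^sub>R cis (t * x) \<partial>lborel) = of_real (sqrt (pi / c) * exp (- t\<^sup>2 / (4 * c)))"
proof -
  define s where "s = sqrt (2 * c)"
  have s: "0 < s" "s\<^sup>2 = 2 * c" using c by (auto simp: s_def)
  have nd: "exp (- c * x\<^sup>2) = sqrt (2 * pi) * std_normal_density (0 + s * x)" for x
    using s by (simp add: normal_density_def power_mult_distrib)
  have i0: "integrable lborel (\<lambda>x. std_normal_density (0 + s * x))"
    by (rule lborel_integrable_real_affine) (use s in auto)
  show "integrable lborel (\<lambda>x. exp (- c * x\<^sup>2))"
    unfolding nd using i0 by simp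
  have "(\<integral>x. std_normal_density x *\<^sub>R cis (t / s * x) \<partial>lborel) = char std_normal_distribution (t / s)"
    by (simp add: char_def cis_conv_exp integral_density normal_density_nonneg mult_ac)
  also have "\<dots> = of_real (exp (- t\<^sup>2 / (4 * c)))"
    using s by (simp add: char_std_normal_distribution power_divide)
  finally have 1: "(\<integral>x. std_normal_density x *\<^sub>R cis (t / s * x) \<partial>lborel) = of_real (exp (- t\<^sup>2 / (4 * c)))" .
  have "(\<integral>x. std_normal_density x *\<^sub>R cis (t / s * x) \<partial>lborel)
      = s *\<^sub>R (\<integral>x. std_normal_density (0 + s * x) *\<^sub>R cis (t * x) \<partial>lborel)"
    using s by (subst lborel_integral_real_affine[where c = s and t = 0]) auto
  then have 2: "(\<integral>x. std_normal_density (0 + s * x) *\<^sub>R cis (t * x) \<partial>lborel) = of_real (exp (- t\<^sup>2 / (4 * c)) / s)"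
    using 1 s by (simp add: scaleR_conv_of_real field_simps)
  have "(\<integral>x. exp (- c * x\<^sup>2) *\<^sub>R cis (t * x) \<partial>lborel)
      = (\<integral>x. sqrt (2 * pi) *\<^sub>R (std_normal_density (0 + s * x) *\<^sub>R cis (t * x)) \<partial>lborel)"
    unfolding nd by simp
  also have "\<dots> = of_real (sqrt (2 * pi) / s * exp (- t\<^sup>2 / (4 * c)))"
    unfolding integral_scaleR_right 2 by (simp add: scaleR_conv_of_real)
  also have "sqrt (2 * pi) / s = sqrt (pi / c)"
    using c by (simp add: s_def real_sqrt_divide[symmetric] del: real_sqrt_divide)
  finally show "(\<integral>x. exp (- c * x\<^sup>2) *\<^sub>R cis (t * x) \<partial>lborel) = of_real (sqrt (pi / c) * exp (- t\<^sup>2 / (4 * c)))" .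
qed

lemma integral_prod_Basis:
  fixes f :: "'a::euclidean_space \<Rightarrow> real \<Rightarrow> complex"
  assumes i: "\<And>b. b \<in> Basis \<Longrightarrow> integrable lborel (f b)"
  shows "integrable lborel (\<lambda>x::'a. \<Prod>b\<in>Basis. f b (x \<bullet> b))"
    and "(\<integral>x. (\<Prod>b\<in>Basis. f b (x \<bullet> b)) \<partial>(lborel::'a measure)) = (\<Prod>b\<in>Basis. \<integral>x. f b x \<partial>lborel)"
proof -
  interpret product_sigma_finite "\<lambda>b::'a. lborel :: real measure"
    by standard
  have [measurable]: "f b \<in> borel_measurable borel" if "b \<in> Basis" for b
    using borel_measurable_integrable[OF i[OF that]] by simp
  have m: "(\<lambda>f::'a\<Rightarrow>real. \<Sum>b\<in>Basis. f b *\<^sub>R b) \<in> (\<Pi>\<^sub>M b\<in>Basis. lborel) \<rightarrow>\<^sub>M borel"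
    by measurable
  have e: "(\<Prod>b\<in>Basis. f b ((\<Sum>b\<in>Basis. g b *\<^sub>R b) \<bullet> b)) = (\<Prod>b\<in>Basis. f b (g b))" for g :: "'a \<Rightarrow> real"
    by (intro prod.cong) auto
  show "integrable lborel (\<lambda>x::'a. \<Prod>b\<in>Basis. f b (x \<bullet> b))"
    by (subst lborel_eq, subst integrable_distr_eq[OF m]) (auto simp: e intro!: product_integrable_prod i)
  show "(\<integral>x. (\<Prod>b\<in>Basis. f b (x \<bullet> b)) \<partial>(lborel::'a measure)) = (\<Prod>b\<in>Basis. \<integral>x. f b x \<partial>lborel)"
    apply (subst (1) lborel_eq)
    apply (subst integral_distr[OF m])
     apply (auto simp: e intro!: product_integral_prod i)
    done
qed

lemma norm_power2_Basis: "(norm x)\<^sup>2 = (\<Sum>b\<in>Basis. (x \<bullet> b)\<^sup>2)" for x :: "'a::euclidean_space"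
  unfolding power2_norm_eq_inner by (subst euclidean_inner) (simp add: power2_eq_square)

lemma cis_sum: "finite I \<Longrightarrow> cis (\<Sum>i\<in>I. f i) = (\<Prod>i\<in>I. cis (f i))"
  by (induction rule: finite_induct) (auto simp: cis_mult[symmetric])

text \<open>
  The Gaussian and the character both factor over the coordinates.
\<close>

lemma gaussian_fourier:
  fixes \<xi> :: "'a::euclidean_space" assumes c: "0 < c"
  shows "integrable lborel (\<lambda>x::'a. exp (- c * (norm x)\<^sup>2))"
    and "(\<integral>x. exp (- c * (norm x)\<^sup>2) *\<^sub>R cis (x \<bullet> \<xi>) \<partial>lborel)
      = of_real (sqrt (pi / c) ^ DIM('a) * exp (- (norm \<xi>)\<^sup>2 / (4 * c)))"
proof -
  define g where "g b x = exp (- c * x\<^sup>2) *\<^sub>R cis ((\<xi> \<bullet> b) * x)" for b :: 'a and x :: real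
  have e: "exp (- c * (norm x)\<^sup>2) *\<^sub>R cis (x \<bullet> \<xi>) = (\<Prod>b\<in>Basis. g b (x \<bullet> b))" for x :: 'a
    unfolding g_def norm_power2_Basis
    by (subst euclidean_inner)
      (simp add: scaleR_conv_of_real prod.distrib cis_sum sum_distrib_left exp_sum mult_ac
        sum_negf[symmetric] del: of_real_exp sum_negf)
  have g: "integrable lborel (g b)" for b
    unfolding g_def
    by (rule Bochner_Integration.integrable_bound[OF gaussian_integral_real(1)[OF c]])
      auto
  have gi: "(\<integral>x. g b x \<partial>lborel) = of_real (sqrt (pi / c) * exp (- (\<xi> \<bullet> b)\<^sup>2 / (4 * c)))" for b
    unfolding g_def by (rule gaussian_integral_real(2)[OF c])
  have "integrable lborel (\<lambda>x::'a. exp (- c * (norm x)\<^sup>2) *\<^sub>R cis (x \<bullet> \<xi>))"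
    unfolding e by (rule integral_prod_Basis(1)) (rule g)
  from integrable_norm[OF this] show "integrable lborel (\<lambda>x::'a. exp (- c * (norm x)\<^sup>2))"
    by simp
  have "(\<integral>x. exp (- c * (norm x)\<^sup>2) *\<^sub>R cis (x \<bullet> \<xi>) \<partial>lborel)
     = (\<Prod>b\<in>Basis. of_real (sqrt (pi / c) * exp (- (\<xi> \<bullet> b)\<^sup>2 / (4 * c))))"
    unfolding e by (subst integral_prod_Basis(2)[OF g]) (simp only: gi)
  also have "\<dots> = of_real (\<Prod>b\<in>Basis. sqrt (pi / c) * exp (- (\<xi> \<bullet> b)\<^sup>2 / (4 * c)))"
    by simp
  also have "(\<Prod>b\<in>Basis. sqrt (pi / c) * exp (- (\<xi> \<bullet> b)\<^sup>2 / (4 * c)))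
     = sqrt (pi / c) ^ DIM('a) * exp (- (norm \<xi>)\<^sup>2 / (4 * c))"
    unfolding norm_power2_Basis by (simp add: prod.distrib exp_sum[symmetric] sum_negf sum_divide_distrib)
  finally show "(\<integral>x. exp (- c * (norm x)\<^sup>2) *\<^sub>R cis (x \<bullet> \<xi>) \<partial>lborel)
      = of_real (sqrt (pi / c) ^ DIM('a) * exp (- (norm \<xi>)\<^sup>2 / (4 * c)))" .
qed

section \<open>Decay of inverse Fourier transforms of smooth symbols\<close>

text \<open>
  The inverse Fourier transform without its normalising constant.
\<close>

definition oscint :: "('a::euclidean_space \<Rightarrow> real) \<Rightarrow> 'a \<Rightarrow> complex" where
  "oscint f x = (\<integral>\<xi>. cis (x \<bullet> \<xi>) * of_real (f \<xi>) \<partial>lborel)"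

lemma integrable_compact_support:
  fixes f :: "'a::euclidean_space \<Rightarrow> real"
  assumes "continuous_on UNIV f" "\<And>x. R < norm x \<Longrightarrow> f x = 0"
  shows "integrable lborel f"
proof -
  have "integrable lborel (\<lambda>x. indicator (cball 0 R) x *\<^sub>R f x)"
    by (rule borel_integrable_compact) (auto intro: continuous_on_subset[OF assms(1)])
  also have "(\<lambda>x. indicator (cball 0 R) x *\<^sub>R f x) = f"
    using assms(2) by (auto simp: fun_eq_iff indicator_def not_le)
  finally show ?thesis .
qed

lemma integrable_cis_mult:
  fixes f :: "'a::euclidean_space \<Rightarrow> real"
  assumes "integrable lborel f"
  shows "integrable lborel (\<lambda>\<xi>. cis (x \<bullet> \<xi>) * of_real (f \<xi>))"
  by (rule Bochner_Integration.integrable_bound[OF assms]) (use assms in \<open>auto simp: norm_mult\<close>)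

lemma frechet_derivative_support:
  fixes f :: "'a::euclidean_space \<Rightarrow> real"
  assumes "\<And>x. R < norm x \<Longrightarrow> f x = 0" "R < norm x"
  shows "frechet_derivative f (at x) b = 0"
proof -
  have "open {x::'a. R < norm x}" by (intro open_Collect_less continuous_intros)
  from frechet_derivative_cong_open[OF this, of x f "\<lambda>_. 0"] assms
  show ?thesis by (simp add: frechet_derivative_const)
qed

text \<open>
  Integration by parts. No boundary terms arise because the derivative is obtained as a limit of
  difference quotients, and translating \<open>f\<close> by \<open>s b\<close> multiplies the integral by a phase with
  derivative \<open>- \<i> (x \<bullet> b)\<close> at \<open>s = 0\<close>.
\<close>

lemma oscint_deriv:
  fixes f :: "'a::euclidean_space \<Rightarrow> real"
  assumes C1: "Cn_on (Suc 0) UNIV f" and supp: "\<And>x. R < norm x \<Longrightarrow> f x = 0" and b: "b \<in> Basis"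
  shows "oscint (\<lambda>\<xi>. frechet_derivative f (at \<xi>) b) x = - \<i> * of_real (x \<bullet> b) * oscint f x"
proof -
  let ?D = "\<lambda>\<xi>. frechet_derivative f (at \<xi>) b"
  define t where "t n = inverse (real (Suc n))" for n
  have t: "0 < t n" "t n \<le> 1" for n by (auto simp: t_def field_simps)
  have tlim: "t \<longlonglongrightarrow> 0" unfolding t_def by (rule LIMSEQ_inverse_real_of_nat)
  have tlim0: "filterlim t (at 0) sequentially"
    unfolding filterlim_at using tlim t(1) by (auto intro!: always_eventually) (metis less_irrefl)
  have der: "((\<lambda>s. f (\<xi> + s *\<^sub>R b)) has_real_derivative ?D (\<xi> + s *\<^sub>R b)) (at s)" for \<xi> s
  proof -
    have d: "(f has_derivative frechet_derivative f (at (\<xi> + s *\<^sub>R b))) (at (\<xi> + s *\<^sub>R b))"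
      using Cn_on_SucD[OF C1] by auto
    have "((\<lambda>s. \<xi> + s *\<^sub>R b) has_derivative (\<lambda>h. h *\<^sub>R b)) (at s)"
      by (auto intro!: derivative_eq_intros)
    from has_derivative_compose[OF this d] show ?thesis
      unfolding has_field_derivative_def
      by (simp add: linear_cmul[OF has_derivative_linear[OF d]] mult.commute[of _ "?D (\<xi> + s *\<^sub>R b)"])
  qed
  have cf: "continuous_on UNIV f" using Cn_on_imp_continuous_on[OF C1] .
  have cD: "continuous_on UNIV ?D" using C1 b by auto
  have [measurable]: "f \<in> borel_measurable borel" "?D \<in> borel_measurable borel"
    using cf cD by (auto intro: borel_measurable_continuous_onI)
  have int_f: "integrable lborel f" by (rule integrable_compact_support[OF cf supp])
  have "compact (?D ` cball 0 R)"
    by (intro compact_continuous_image continuous_on_subset[OF cD]) auto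
  then obtain M where M: "\<And>\<xi>. \<xi> \<in> cball 0 R \<Longrightarrow> \<bar>?D \<xi>\<bar> \<le> M"
    by (meson compact_imp_bounded bounded_real image_eqI)
  have M': "\<bar>?D \<xi>\<bar> \<le> max M 0" for \<xi>
    using M[of \<xi>] frechet_derivative_support[OF supp, where x = \<xi> and b = b]
    by (cases "norm \<xi> \<le> R") auto
  define h where "h n \<xi> = (f (\<xi> + t n *\<^sub>R b) - f \<xi>) / t n" for n \<xi>
  have h0: "h n \<xi> = 0" if "R + 1 < norm \<xi>" for n \<xi>
  proof -
    have "norm \<xi> \<le> norm (\<xi> + t n *\<^sub>R b) + norm (t n *\<^sub>R b)"
      using norm_triangle_sub[of \<xi> "- t n *\<^sub>R b"] by simp
    also have "norm (t n *\<^sub>R b) \<le> 1" using t[of n] b by simp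
    finally show ?thesis using that by (simp add: h_def supp)
  qed
  have hb: "\<bar>h n \<xi>\<bar> \<le> max M 0" for n \<xi>
  proof -
    obtain z where z: "f (\<xi> + t n *\<^sub>R b) - f (\<xi> + 0 *\<^sub>R b) = (t n - 0) * ?D (\<xi> + z *\<^sub>R b)"
      using MVT2[of 0 "t n" "\<lambda>s. f (\<xi> + s *\<^sub>R b)" "\<lambda>s. ?D (\<xi> + s *\<^sub>R b)", OF t(1) der]
      by blast
    then show ?thesis using t(1)[of n] M'[of "\<xi> + z *\<^sub>R b"] by (simp add: h_def)
  qed
  have hlim: "(\<lambda>n. h n \<xi>) \<longlonglongrightarrow> ?D \<xi>" for \<xi>
  proof -
    have "((\<lambda>s. (f (\<xi> + s *\<^sub>R b) - f \<xi>) / s) \<longlongrightarrow> ?D \<xi>) (at 0)"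
      using der[of \<xi> 0] by (simp add: DERIV_def)
    then show ?thesis unfolding h_def
      by (rule filterlim_compose[OF _ tlim0])
  qed
  have "(\<lambda>n. \<integral>\<xi>. cis (x \<bullet> \<xi>) * of_real (h n \<xi>) \<partial>lborel) \<longlonglongrightarrow> (\<integral>\<xi>. cis (x \<bullet> \<xi>) * of_real (?D \<xi>) \<partial>lborel)"
  proof (rule integral_dominated_convergence[where w = "\<lambda>\<xi>. max M 0 * indicator (cball 0 (R + 1)) \<xi>"])
    show "integrable lborel (\<lambda>\<xi>::'a. max M 0 * indicator (cball 0 (R + 1)) \<xi>)"
      by (intro integrable_mult_right integrable_real_indicator) (use emeasure_lborel_cball_finite[of "0::'a" "R + 1"] in auto)
    show "AE \<xi> in lborel. (\<lambda>n. cis (x \<bullet> \<xi>) * of_real (h n \<xi>)) \<longlonglongrightarrow> cis (x \<bullet> \<xi>) * of_real (?D \<xi>)"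
      by (intro always_eventually allI tendsto_intros hlim)
    show "AE \<xi> in lborel. norm (cis (x \<bullet> \<xi>) * of_real (h n \<xi>)) \<le> max M 0 * indicator (cball 0 (R + 1)) \<xi>" for n
      using hb h0 by (intro always_eventually allI) (auto simp: norm_mult indicator_def not_le)
  qed (auto simp: h_def)
  moreover have "(\<integral>\<xi>. cis (x \<bullet> \<xi>) * of_real (h n \<xi>) \<partial>lborel)
       = of_real (inverse (t n)) * (cis (- (x \<bullet> b) * t n) - 1) * oscint f x" for n
  proof -
    let ?g = "\<lambda>\<xi>. cis (x \<bullet> \<xi>) * of_real (f \<xi>)"
    have g: "integrable lborel ?g" by (rule integrable_cis_mult[OF int_f])
    have e: "cis (x \<bullet> \<xi>) * of_real (f (\<xi> + t n *\<^sub>R b)) = cis (- (x \<bullet> b) * t n) * ?g (t n *\<^sub>R b + 1 *\<^sub>R \<xi>)" for \<xi>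
      by (simp add: mult.assoc[symmetric] cis_mult inner_add_right algebra_simps)
    have g': "integrable lborel (\<lambda>\<xi>. ?g (t n *\<^sub>R b + 1 *\<^sub>R \<xi>))"
    proof -
      have "integrable (distr lborel borel ((+) (t n *\<^sub>R b))) ?g"
        using g lborel_distr_plus[of "t n *\<^sub>R b"] by simp
      then show ?thesis by (simp add: integrable_distr_eq)
    qed
    have i': "(\<integral>\<xi>. ?g (t n *\<^sub>R b + 1 *\<^sub>R \<xi>) \<partial>lborel) = oscint f x"
      using integral_lborel_affine[of ?g 1 "t n *\<^sub>R b"] by (simp add: oscint_def)
    have "(\<integral>\<xi>. cis (x \<bullet> \<xi>) * of_real (h n \<xi>) \<partial>lborel)
       = (\<integral>\<xi>. of_real (inverse (t n)) * (cis (- (x \<bullet> b) * t n) * ?g (t n *\<^sub>R b + 1 *\<^sub>R \<xi>) - ?g \<xi>) \<partial>lborel)"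
      unfolding e[symmetric] h_def by (intro Bochner_Integration.integral_cong) (auto simp: field_simps)
    also have "\<dots> = of_real (inverse (t n)) * (cis (- (x \<bullet> b) * t n) * oscint f x - oscint f x)"
      by (subst integral_mult_right_zero, subst Bochner_Integration.integral_diff)
         (use g g' i' in \<open>auto simp: oscint_def\<close>)
    finally show ?thesis by (simp add: algebra_simps)
  qed
  moreover have "(\<lambda>n. of_real (inverse (t n)) * (cis (- (x \<bullet> b) * t n) - 1) * oscint f x)
      \<longlonglongrightarrow> - \<i> * of_real (x \<bullet> b) * oscint f x"
  proof (rule tendsto_mult[OF _ tendsto_const])
        define c where "c = - \<i> * complex_of_real (x \<bullet> b)"
    have "((\<lambda>z. exp (c * z)) has_field_derivative c) (at 0)"
      by (auto intro!: derivative_eq_intros)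
    then have lim: "((\<lambda>z. (exp (c * z) - 1) / z) \<longlongrightarrow> c) (at 0)"
      by (simp add: DERIV_def)
    have "(\<lambda>n. complex_of_real (t n)) \<longlonglongrightarrow> of_real 0"
      by (intro tendsto_of_real tlim)
    then have "filterlim (\<lambda>n. complex_of_real (t n)) (at 0) sequentially"
      unfolding filterlim_at using t(1) by (auto intro!: always_eventually) (metis less_irrefl)
    from filterlim_compose[OF lim this]
    show "(\<lambda>n. of_real (inverse (t n)) * (cis (- (x \<bullet> b) * t n) - 1)) \<longlonglongrightarrow> - \<i> * of_real (x \<bullet> b)"
      by (simp add: c_def cis_conv_exp field_simps)
  qed
  ultimately show ?thesis unfolding oscint_def using LIMSEQ_unique by (metis (no_types, lifting) ext)
qed

text \<open>
  The operator \<open>g - \<partial>\<^sub>b\<partial>\<^sub>bg\<close> corresponds to multiplication by \<open>1 + (x \<bullet> b)\<^sup>2\<close>. It preserves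
  smoothness and the support, so it can be applied once for every direction.
\<close>

lemma oscint_weight:
  fixes f :: "'a::euclidean_space \<Rightarrow> real"
  assumes "finite B" "B \<subseteq> Basis" "\<And>n. Cn_on n UNIV f" "\<And>x. R < norm x \<Longrightarrow> f x = 0"
  shows "\<exists>g. (\<forall>n. Cn_on n UNIV g) \<and> (\<forall>x. R < norm x \<longrightarrow> g x = 0) \<and>
    (\<forall>x. oscint g x = of_real (\<Prod>b\<in>B. 1 + (x \<bullet> b)\<^sup>2) * oscint f x)"
  using assms
proof (induction B rule: finite_induct)
  case empty
  then show ?case by (intro exI[of _ f]) auto
next
  case (insert b B)
  then obtain g where g: "\<And>n. Cn_on n UNIV g" "\<And>x. R < norm x \<Longrightarrow> g x = 0"
    "\<And>x. oscint g x = of_real (\<Prod>b\<in>B. 1 + (x \<bullet> b)\<^sup>2) * oscint f x" and b: "b \<in> Basis" by auto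
  define d where "d = (\<lambda>\<xi>. frechet_derivative g (at \<xi>) b)"
  define e where "e = (\<lambda>\<xi>. frechet_derivative d (at \<xi>) b)"
  have d: "Cn_on n UNIV d" "\<And>x. R < norm x \<Longrightarrow> d x = 0" for n
    using g(1)[of "Suc n"] b frechet_derivative_support[OF g(2)] by (auto simp: d_def)
  have e: "Cn_on n UNIV e" "\<And>x. R < norm x \<Longrightarrow> e x = 0" for n
    using d(1)[of "Suc n"] b frechet_derivative_support[OF d(2)] by (auto simp: e_def)
  have ig: "integrable lborel g" and ie: "integrable lborel e"
    using g e by (auto intro!: integrable_compact_support[of _ R] intro: Cn_on_imp_continuous_on[of 0])
  show ?case
  proof (intro exI[of _ "\<lambda>x. g x - e x"] conjI allI impI)
    show "Cn_on n UNIV (\<lambda>x. g x - e x)" for n by (intro Cn_on_diff g e) auto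
    fix x :: 'a
    have "oscint (\<lambda>x. g x - e x) x = oscint g x - oscint e x"
      unfolding oscint_def
      by (subst Bochner_Integration.integral_diff[symmetric])
        (auto intro!: integrable_cis_mult ig ie simp: right_diff_distrib)
    also have "oscint e x = - \<i> * of_real (x \<bullet> b) * (- \<i> * of_real (x \<bullet> b) * oscint g x)"
      unfolding e_def using oscint_deriv[OF d(1,2) b] oscint_deriv[OF g(1,2) b] by (simp add: d_def)
    finally have "oscint (\<lambda>x. g x - e x) x = of_real (1 + (x \<bullet> b)\<^sup>2) * oscint g x"
      by (simp add: algebra_simps power2_eq_square)
    also have "\<dots> = of_real (\<Prod>b\<in>insert b B. 1 + (x \<bullet> b)\<^sup>2) * oscint f x"
      using insert by (simp add: g mult.assoc)
    finally show "oscint (\<lambda>x. g x - e x) x = of_real (\<Prod>b\<in>insert b B. 1 + (x \<bullet> b)\<^sup>2) * oscint f x" .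
  qed (use g e in auto)
qed

text \<open>
  A product over the coordinates, rather than a power of the norm, so that its integral is a product
  of one-dimensional integrals.
\<close>

definition decay_weight :: "'a::euclidean_space \<Rightarrow> real" where
  "decay_weight x = (\<Prod>b\<in>Basis. inverse (1 + (x \<bullet> b)\<^sup>2))"

lemma decay_weight_pos: "0 < decay_weight x"
  unfolding decay_weight_def by (intro prod_pos) (auto intro: add_pos_nonneg)

lemma decay_weight_le_1: "decay_weight x \<le> 1"
  unfolding decay_weight_def by (intro prod_le_1) (auto intro!: inverse_le_1_iff[THEN iffD2])

lemma borel_measurable_decay_weight[measurable]: "decay_weight \<in> borel_measurable borel"
  unfolding decay_weight_def by measurable

lemma nn_integral_inverse_1_plus_sq:
  "(\<integral>\<^sup>+x. ennreal (inverse (1 + x\<^sup>2)) \<partial>(lborel :: real measure)) = ennreal pi"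
proof -
  have A: "((arctan \<circ> real_of_ereal) \<longlongrightarrow> - (pi / 2)) (at_right (-\<infinity>))"
    and B: "((arctan \<circ> real_of_ereal) \<longlongrightarrow> pi / 2) (at_left \<infinity>)"
    unfolding ereal_tendsto_simps
    by (simp_all add: tendsto_arctan_at_bot tendsto_arctan_at_top)
  have D: "DERIV arctan x :> inverse (1 + x\<^sup>2)" for x by (rule DERIV_arctan)
  have C: "isCont (\<lambda>x. inverse (1 + x\<^sup>2)) x" for x :: real
    by (intro continuous_intros) (metis add_pos_nonneg less_irrefl zero_le_power2 zero_less_one)
  note ftc = interval_integral_FTC_nonneg[OF _ D C _ A B]
  have "set_integrable lborel (einterval (-\<infinity>) \<infinity>) (\<lambda>x::real. inverse (1 + x\<^sup>2))"
    and "(LBINT x=-\<infinity>..\<infinity>. inverse (1 + x\<^sup>2)) = pi"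
    using ftc by auto
  then show ?thesis
    by (subst nn_integral_eq_integral)
      (auto simp: set_integrable_def interval_lebesgue_integral_def set_lebesgue_integral_def)
qed

lemma decay_weight_integrable:
  "(\<integral>\<^sup>+x. ennreal (decay_weight (x::'a::euclidean_space)) \<partial>lborel) = ennreal (pi ^ DIM('a))"
proof -
  have "(\<integral>\<^sup>+x. ennreal (decay_weight (x::'a::euclidean_space)) \<partial>lborel)
     = (\<integral>\<^sup>+x. (\<Prod>b\<in>Basis. ennreal (inverse (1 + (x \<bullet> b)\<^sup>2))) \<partial>(lborel::'a measure))"
    unfolding decay_weight_def by (subst prod_ennreal[symmetric]) auto
  also have "\<dots> = (\<Prod>b\<in>(Basis::'a set). \<integral>\<^sup>+x. ennreal (inverse (1 + x\<^sup>2)) \<partial>lborel)"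
    by (subst nn_integral_lborel_prod) auto
  also have "(\<integral>\<^sup>+x. ennreal (inverse (1 + x\<^sup>2)) \<partial>(lborel :: real measure)) = ennreal pi"
    by (rule nn_integral_inverse_1_plus_sq)
  also have "(\<Prod>b\<in>(Basis::'a set). ennreal pi) = ennreal (pi ^ DIM('a))"
    by (simp add: ennreal_power)
  finally show ?thesis .
qed

lemma inv_fourier_decay:
  fixes f :: "'a::euclidean_space \<Rightarrow> real"
  assumes "\<And>n. Cn_on n UNIV f" "\<And>x. R < norm x \<Longrightarrow> f x = 0"
  shows "\<exists>C>0. \<forall>x. norm (inv_fourier f x) \<le> C * decay_weight x"
proof -
  obtain g where g: "\<And>n. Cn_on n UNIV g" "\<And>x. R < norm x \<Longrightarrow> g x = 0"
    "\<And>x. oscint g x = of_real (\<Prod>b\<in>Basis. 1 + (x \<bullet> b)\<^sup>2) * oscint f x"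
    using oscint_weight[OF finite_Basis subset_refl assms] by blast
  have ig: "integrable lborel g"
    by (rule integrable_compact_support[OF _ g(2)]) (use g(1)[of 0] in simp)
  define I where "I = (\<integral>x. \<bar>g x\<bar> \<partial>lborel)"
  have I: "0 \<le> I" unfolding I_def by simp
  have bd: "norm (oscint g x) \<le> I" for x
    unfolding oscint_def I_def
    by (rule order_trans[OF integral_norm_bound]) (simp add: norm_mult)
  have "norm (oscint f x) \<le> (I + 1) * decay_weight x" for x
  proof -
    let ?P = "\<Prod>b\<in>Basis. 1 + (x \<bullet> b)\<^sup>2"
    have P: "0 < ?P" by (intro prod_pos) (auto intro: add_pos_nonneg)
    have "decay_weight x = inverse ?P" unfolding decay_weight_def using prod_inversef[of "\<lambda>b. 1 + (x \<bullet> b)\<^sup>2" Basis] by (simp add: o_def)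
    moreover have "?P * norm (oscint f x) \<le> I + 1"
      using bd[of x] P unfolding g(3) norm_mult norm_of_real by simp
    ultimately show ?thesis using P by (simp add: field_simps)
  qed
  then have "(1 / (2 * pi) ^ DIM('a)) * norm (oscint f x) \<le> (1 / (2 * pi) ^ DIM('a)) * ((I + 1) * decay_weight x)" for x
    by (intro mult_left_mono) auto
  then show ?thesis using I
    by (intro exI[of _ "(1 / (2 * pi) ^ DIM('a)) * (I + 1)"]) (auto simp: inv_fourier_def oscint_def mult.assoc)
qed

section \<open>Inequalities for Lebesgue norms\<close>

lemma borel_measurable_epow[measurable (raw)]:
  assumes [measurable]: "f \<in> borel_measurable M"
  shows "(\<lambda>x. epow (f x) a) \<in> borel_measurable M"
  unfolding epow_def by measurable

lemma epow_ennreal: "0 \<le> x \<Longrightarrow> epow (ennreal x) a = ennreal (x powr a)"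
  by (simp add: epow_def)

lemma epow_top [simp]: "epow \<infinity> a = \<infinity>" "epow top a = \<infinity>"
  by (simp_all add: epow_def)

lemma epow_0 [simp]: "epow 0 a = 0"
  by (simp add: epow_def)

lemma epow_mono: "x \<le> y \<Longrightarrow> 0 \<le> a \<Longrightarrow> epow x a \<le> epow y a"
  by (cases x; cases y) (auto simp: epow_ennreal powr_mono2 top_unique)

lemma epow_mult:
  assumes "0 < a"
  shows "epow (x * y) a = epow x a * epow y a"
proof (cases x; cases y)
  fix r s assume "0 \<le> r" "x = ennreal r" "0 \<le> s" "y = ennreal s"
  then show ?thesis by (simp add: epow_ennreal ennreal_mult[symmetric] powr_mult)
qed (use assms in \<open>auto simp: epow_ennreal ennreal_mult_top ennreal_top_mult\<close>)

lemma epow_epow: "0 < a \<Longrightarrow> epow (epow x a) b = epow x (a * b)"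
  by (cases x) (auto simp: epow_ennreal powr_powr)

lemma epow_1 [simp]: "epow x 1 = x"
  by (cases x) (auto simp: epow_ennreal)

text \<open>
  Young's inequality applied to \<open>u\<^sup>p t\<^sup>1\<^sup>-\<^sup>p\<close> and \<open>t\<close>: the tangent line bound for the convex
  function \<open>u\<^sup>p\<close> at \<open>u = t\<close>.
\<close>

lemma young_ineq_scaled:
  fixes u t p :: real
  assumes "0 \<le> u" "0 < t" "1 \<le> p"
  shows "u \<le> t powr (1 - p) / p * u powr p + (1 - 1 / p) * t"
proof (cases "u = 0")
  case True
  then show ?thesis using assms by simp
next
  case False
  have "(u powr p * t powr (1 - p)) powr (1 / p) * t powr (1 - 1 / p)
      \<le> (1 / p) * (u powr p * t powr (1 - p)) + (1 - 1 / p) * t"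
    using assms False by (intro Youngs_inequality_0) auto
  moreover have "(u powr p * t powr (1 - p)) powr (1 / p) * t powr (1 - 1 / p) = u"
  proof -
    have "(u powr p * t powr (1 - p)) powr (1 / p) * t powr (1 - 1 / p)
       = u * (t powr ((1 - p) / p) * t powr (1 - 1 / p))"
      using assms by (simp add: powr_mult powr_powr)
    also have "\<dots> = u"
      using assms by (simp add: powr_add[symmetric] diff_divide_distrib)
    finally show ?thesis .
  qed
  ultimately show ?thesis by (simp add: field_simps)
qed

text \<open>
  Integrating the tangent line bound and choosing the best tangent point, which is the
  \<open>p\<close>-th root of the weighted mean of \<open>f\<^sup>p\<close>. Both Hoelder's inequality in the radius and Young's
  inequality for convolutions are instances.
\<close>

lemma weighted_jensen:
  fixes f v :: "'b \<Rightarrow> ennreal" and p A :: real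
  assumes [measurable]: "f \<in> borel_measurable M" "v \<in> borel_measurable M"
    and p: "1 \<le> p" and A: "0 < A" and v: "(\<integral>\<^sup>+x. v x \<partial>M) \<le> ennreal A"
  shows "epow (\<integral>\<^sup>+x. v x * f x \<partial>M) p \<le> ennreal (A powr (p - 1)) * (\<integral>\<^sup>+x. v x * epow (f x) p \<partial>M)"
proof (cases "\<integral>\<^sup>+x. v x * epow (f x) p \<partial>M")
  case top
  then show ?thesis using A by (simp add: ennreal_mult_top)
next
  case (real i)
  have ineq: "(\<integral>\<^sup>+x. v x * f x \<partial>M) \<le> ennreal (t powr (1 - p) / p * i + (1 - 1 / p) * t * A)"
    if t: "0 < t" for t
  proof -
    have pt: "f x \<le> ennreal (t powr (1 - p) / p) * epow (f x) p + ennreal ((1 - 1 / p) * t)" for x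
    proof (cases "f x")
      case (real u)
      then show ?thesis
        using young_ineq_scaled[of u t p] p t
        by (simp add: epow_ennreal ennreal_mult[symmetric] ennreal_plus[symmetric] ennreal_leI
            del: ennreal_plus)
    next
      case top
      then show ?thesis using p t by (simp add: ennreal_mult_top)
    qed
    have "(\<integral>\<^sup>+x. v x * f x \<partial>M)
       \<le> (\<integral>\<^sup>+x. ennreal (t powr (1 - p) / p) * (v x * epow (f x) p) + ennreal ((1 - 1 / p) * t) * v x \<partial>M)"
    proof (intro nn_integral_mono)
      fix x
      show "v x * f x \<le> ennreal (t powr (1 - p) / p) * (v x * epow (f x) p) + ennreal ((1 - 1 / p) * t) * v x"
        using mult_left_mono[OF pt, of "v x" x] by (simp add: distrib_left mult_ac)
    qed
    also have "\<dots> = ennreal (t powr (1 - p) / p) * ennreal i + ennreal ((1 - 1 / p) * t) * (\<integral>\<^sup>+x. v x \<partial>M)"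
      by (simp add: nn_integral_add nn_integral_cmult real)
    also have "\<dots> \<le> ennreal (t powr (1 - p) / p) * ennreal i + ennreal ((1 - 1 / p) * t) * ennreal A"
      by (intro add_left_mono mult_left_mono v) auto
    also have "\<dots> = ennreal (t powr (1 - p) / p * i + (1 - 1 / p) * t * A)"
      using p t A real by (simp add: ennreal_mult[symmetric] ennreal_plus[symmetric] del: ennreal_plus)
    finally show ?thesis .
  qed
  then have "(\<integral>\<^sup>+x. v x * f x \<partial>M) < top"
    using ineq[of 1] by (meson ennreal_less_top le_less_trans zero_less_one)
  then obtain x where x: "0 \<le> x" "(\<integral>\<^sup>+x. v x * f x \<partial>M) = ennreal x"
    by (cases "\<integral>\<^sup>+x. v x * f x \<partial>M") auto
  have le: "x \<le> t powr (1 - p) / p * i + (1 - 1 / p) * t * A" if "0 < t" for t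
  proof -
    have "0 \<le> t powr (1 - p) / p * i + (1 - 1 / p) * t * A"
      using p that A real by (intro add_nonneg_nonneg mult_nonneg_nonneg) auto
    then show ?thesis using ineq[OF that] x by (simp add: ennreal_le_iff)
  qed
  have "x powr p \<le> A powr (p - 1) * i"
  proof (cases "i = 0")
    case True
    \<comment> \<open>The optimal tangent point would be \<open>0\<close>, which is not admissible; it is approached instead.\<close>
    have "x \<le> e" if "0 < e" for e
    proof -
      have "x \<le> (1 - 1 / p) * (e / A) * A" using le[of "e / A"] True that A by simp
      also have "\<dots> \<le> 1 * (e / A) * A"
        using p A that by (intro mult_right_mono) auto
      finally show ?thesis using A by simp
    qed
    then have "x = 0" using field_le_epsilon[of x 0] x(1) by force
    then show ?thesis using True by simp
  next
    case False
    then have i: "0 < i" using real by simp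
    \<comment> \<open>At this tangent point both terms of the bound are multiples of \<open>t A\<close>.\<close>
    define t where "t = (i / A) powr (1 / p)"
    have t: "0 < t" using i A by (simp add: t_def)
    have tp: "t powr p = i / A" using i A p by (simp add: t_def powr_powr)
    have "t powr (1 - p) = t * A / i"
      using t tp i A by (simp add: powr_diff)
    with le[OF t] have "x \<le> t * A / p + (1 - 1 / p) * t * A" using i by simp
    also have "\<dots> = t * A" by (simp add: algebra_simps)
    finally have "x powr p \<le> (t * A) powr p"
      using x p by (intro powr_mono2) auto
    also have "\<dots> = A powr (p - 1) * i"
      using t A tp by (simp add: powr_mult powr_diff)
    finally show ?thesis .
  qed
  then show ?thesis using x real by (simp add: epow_ennreal ennreal_mult[symmetric] ennreal_leI)
qed

lemma enn2real_ge_1: "1 \<le> (p::ennreal) \<Longrightarrow> p \<noteq> \<infinity> \<Longrightarrow> 1 \<le> enn2real p"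
  by (cases p) auto

lemma Lp_norm_finite_exp:
  "p \<noteq> \<infinity> \<Longrightarrow> Lp_norm M p f = epow (\<integral>\<^sup>+ x. epow (f x) (enn2real p) \<partial>M) (1 / enn2real p)"
  by (simp add: Lp_norm_def)

lemma Lp_norm_mono:
  assumes "f \<in> borel_measurable M" "\<And>x. f x \<le> g x"
  shows "Lp_norm M p f \<le> Lp_norm M p g"
  using assms unfolding Lp_norm_def
  by (auto intro!: epow_mono nn_integral_mono esssup_mono)

text \<open>
  Hoelder's inequality for a weight that is bounded and integrable, hence in every conjugate space.
\<close>

lemma weighted_integral_le_Lp_norm:
  fixes f v :: "'b \<Rightarrow> ennreal" and A B :: real
  assumes [measurable]: "f \<in> borel_measurable M" "v \<in> borel_measurable M"
    and p: "1 \<le> p" "p \<noteq> \<infinity>" and A: "0 < A" "(\<integral>\<^sup>+x. v x \<partial>M) \<le> ennreal A"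
    and B: "0 < B" "\<And>x. v x \<le> ennreal B"
  shows "(\<integral>\<^sup>+x. v x * f x \<partial>M)
     \<le> ennreal ((A powr (enn2real p - 1) * B) powr (1 / enn2real p)) * Lp_norm M p f"
proof -
  let ?p = "enn2real p"
  have p1: "1 \<le> ?p" using enn2real_ge_1[OF p] .
  have "epow (\<integral>\<^sup>+x. v x * f x \<partial>M) ?p \<le> ennreal (A powr (?p - 1)) * (\<integral>\<^sup>+x. v x * epow (f x) ?p \<partial>M)"
    by (rule weighted_jensen[OF _ _ p1 A]) measurable
  also have "\<dots> \<le> ennreal (A powr (?p - 1)) * (\<integral>\<^sup>+x. ennreal B * epow (f x) ?p \<partial>M)"
    by (intro mult_left_mono nn_integral_mono mult_right_mono B) auto
  also have "\<dots> = ennreal (A powr (?p - 1) * B) * (\<integral>\<^sup>+x. epow (f x) ?p \<partial>M)"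
    using B by (simp add: nn_integral_cmult ennreal_mult mult.assoc)
  finally have "epow (epow (\<integral>\<^sup>+x. v x * f x \<partial>M) ?p) (1 / ?p)
     \<le> epow (ennreal (A powr (?p - 1) * B) * (\<integral>\<^sup>+x. epow (f x) ?p \<partial>M)) (1 / ?p)"
    by (rule epow_mono) (use p1 in auto)
  then show ?thesis
    using p1 p B by (simp add: epow_epow epow_mult epow_ennreal Lp_norm_finite_exp)
qed

text \<open>
  Young's inequality. For finite exponents it follows by integrating, over \<open>x\<close>, Jensen's inequality
  for the measure with density \<open>l (x - y)\<close> in \<open>y\<close>.
\<close>

lemma Lp_norm_convolution_le:
  fixes l g :: "'a::euclidean_space \<Rightarrow> ennreal" and A :: real
  assumes [measurable]: "l \<in> borel_measurable borel" "g \<in> borel_measurable borel"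
    and q: "1 \<le> q" and A: "0 < A" "(\<integral>\<^sup>+y. l y \<partial>lborel) \<le> ennreal A"
  shows "Lp_norm lborel q (\<lambda>x. \<integral>\<^sup>+y. l (x - y) * g y \<partial>lborel) \<le> ennreal A * Lp_norm lborel q g"
proof (cases "q = \<infinity>")
  case True
  have "(\<integral>\<^sup>+y. l (x - y) * g y \<partial>lborel) \<le> ennreal A * esssup lborel g" for x
  proof -
    have "(\<integral>\<^sup>+y. l (x - y) * g y \<partial>lborel) \<le> (\<integral>\<^sup>+y. l (x - y) * esssup lborel g \<partial>lborel)"
      by (intro nn_integral_mono_AE, use esssup_AE[of g lborel] in eventually_elim) (auto intro: mult_left_mono)
    also have "\<dots> = (\<integral>\<^sup>+y. l y \<partial>lborel) * esssup lborel g"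
      by (simp add: nn_integral_multc nn_integral_lborel_reflect)
    also have "\<dots> \<le> ennreal A * esssup lborel g"
      by (intro mult_right_mono A) auto
    finally show ?thesis .
  qed
  then show ?thesis unfolding Lp_norm_def using True
    by (auto intro!: esssup_I)
next
  case False
  let ?q = "enn2real q"
  have q1: "1 \<le> ?q" using enn2real_ge_1[OF q False] .
  have "(\<integral>\<^sup>+x. epow (\<integral>\<^sup>+y. l (x - y) * g y \<partial>lborel) ?q \<partial>lborel)
     \<le> (\<integral>\<^sup>+x. ennreal (A powr (?q - 1)) * (\<integral>\<^sup>+y. l (x - y) * epow (g y) ?q \<partial>lborel) \<partial>lborel)"
  proof (intro nn_integral_mono weighted_jensen q1 A)
    fix x
    show "(\<integral>\<^sup>+y. l (x - y) \<partial>lborel) \<le> ennreal A"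
      using A by (simp add: nn_integral_lborel_reflect)
  qed auto
  also have "\<dots> = ennreal (A powr (?q - 1)) * (\<integral>\<^sup>+x. (\<integral>\<^sup>+y. l (x - y) * epow (g y) ?q \<partial>lborel) \<partial>lborel)"
    by (simp add: nn_integral_cmult)
  also have "(\<integral>\<^sup>+x. (\<integral>\<^sup>+y. l (x - y) * epow (g y) ?q \<partial>lborel) \<partial>lborel)
     = (\<integral>\<^sup>+y. (\<integral>\<^sup>+x. l (x - y) * epow (g y) ?q \<partial>lborel) \<partial>lborel)"
    by (rule lborel_pair.Fubini') measurable
  also have "\<dots> = (\<integral>\<^sup>+y. (\<integral>\<^sup>+x. l x \<partial>lborel) * epow (g y) ?q \<partial>lborel)"
    using nn_integral_lborel_affine[of l 1 "- _"]
    by (simp add: nn_integral_multc)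
  also have "\<dots> = (\<integral>\<^sup>+x. l x \<partial>lborel) * (\<integral>\<^sup>+y. epow (g y) ?q \<partial>lborel)"
    by (simp add: nn_integral_cmult)
  also have "ennreal (A powr (?q - 1)) * ((\<integral>\<^sup>+x. l x \<partial>lborel) * (\<integral>\<^sup>+y. epow (g y) ?q \<partial>lborel))
    \<le> ennreal (A powr (?q - 1)) * (ennreal A * (\<integral>\<^sup>+y. epow (g y) ?q \<partial>lborel))"
    by (intro mult_left_mono mult_right_mono A) auto
  also have "\<dots> = ennreal (A powr ?q) * (\<integral>\<^sup>+y. epow (g y) ?q \<partial>lborel)"
    using A by (simp add: mult.assoc[symmetric] ennreal_mult[symmetric] powr_diff)
  finally have "epow (\<integral>\<^sup>+x. epow (\<integral>\<^sup>+y. l (x - y) * g y \<partial>lborel) ?q \<partial>lborel) (1 / ?q)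
     \<le> epow (ennreal (A powr ?q) * (\<integral>\<^sup>+y. epow (g y) ?q \<partial>lborel)) (1 / ?q)"
    by (rule epow_mono) (use q1 in auto)
  then show ?thesis
    using q1 A False by (simp add: epow_mult epow_ennreal powr_powr Lp_norm_finite_exp)
qed

text \<open>
  A function below \<open>1\<close> has \<open>v\<^sup>q \<le> v\<close>. For \<open>q = \<infinity>\<close> the exponent \<open>1 / enn2real q\<close> is \<open>0\<close>, so
  the same constant covers this case.
\<close>

lemma Lp_norm_le_of_bounded_integrable:
  fixes f v :: "'b \<Rightarrow> ennreal" and c A :: real
  assumes [measurable]: "f \<in> borel_measurable M" "v \<in> borel_measurable M"
    and q: "1 \<le> q" and A: "0 < A" "(\<integral>\<^sup>+x. v x \<partial>M) \<le> ennreal A"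
    and v: "\<And>x. v x \<le> 1" and f: "\<And>x. f x \<le> c * v x"
  shows "Lp_norm M q f \<le> c * ennreal (A powr (1 / enn2real q))"
proof (cases "q = \<infinity>")
  case True
  have "f x \<le> c" for x
    using f[of x] mult_left_mono[OF v[of x], of "ennreal c"] by (simp add: order_trans)
  then show ?thesis using True A by (auto simp: Lp_norm_def intro!: esssup_I)
next
  case False
  let ?q = "enn2real q"
  have q1: "1 \<le> ?q" using enn2real_ge_1[OF q False] .
  have "epow (f x) ?q \<le> epow c ?q * v x" for x
  proof -
    have "epow (v x) ?q \<le> v x"
    proof (cases "v x")
      case (real r)
      then have "r \<le> 1" using v[of x] by (simp add: ennreal_le_1)
      then have "r powr ?q \<le> r"
        using powr_mono'[of 1 ?q r] q1 real by (cases "r = 0") auto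
      then show ?thesis using real by (simp add: epow_ennreal ennreal_leI)
    qed (use v[of x] in auto)
    then have "epow c ?q * epow (v x) ?q \<le> epow c ?q * v x" by (rule mult_left_mono) auto
    moreover have "epow (f x) ?q \<le> epow c ?q * epow (v x) ?q"
      using epow_mono[OF f[of x], of ?q] q1 by (simp add: epow_mult)
    ultimately show ?thesis by (rule order_trans[rotated])
  qed
  then have "(\<integral>\<^sup>+x. epow (f x) ?q \<partial>M) \<le> (\<integral>\<^sup>+x. epow c ?q * v x \<partial>M)"
    by (intro nn_integral_mono)
  also have "\<dots> \<le> epow c ?q * ennreal A"
    by (simp add: nn_integral_cmult mult_left_mono A)
  finally have "epow (\<integral>\<^sup>+x. epow (f x) ?q \<partial>M) (1 / ?q) \<le> epow (epow c ?q * ennreal A) (1 / ?q)"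
    by (rule epow_mono) (use q1 in auto)
  then show ?thesis
    using q1 False A by (simp add: epow_mult epow_epow epow_ennreal Lp_norm_finite_exp)
qed

lemma Lp_norm_ge_on_set:
  fixes f :: "'b \<Rightarrow> ennreal" and m :: ennreal and \<eta> :: real
  assumes E: "E \<in> sets M" "0 < \<eta>" "ennreal \<eta> \<le> emeasure M E" and p: "1 \<le> p"
    and f: "\<And>x. x \<in> E \<Longrightarrow> m \<le> f x"
  shows "m * ennreal (\<eta> powr (1 / enn2real p)) \<le> Lp_norm M p f"
proof (cases "p = \<infinity>")
  case True
  have "m \<le> esssup M f"
  proof (rule ccontr)
    assume "\<not> m \<le> esssup M f"
    then have "AE x in M. x \<notin> E"
      using esssup_AE[of f M] f by (auto elim!: eventually_mono) (meson order_trans)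
    then have "emeasure M E = 0"
      using AE_iff_null_sets[OF E(1)] by auto
    then show False using E by simp
  qed
  then show ?thesis using True E by (simp add: Lp_norm_def)
next
  case False
  let ?p = "enn2real p"
  have p1: "1 \<le> ?p" using enn2real_ge_1[OF p False] .
  have "epow m ?p * ennreal \<eta> \<le> epow m ?p * emeasure M E"
    by (intro mult_left_mono E) auto
  also have "\<dots> = (\<integral>\<^sup>+x. epow m ?p * indicator E x \<partial>M)"
    using E(1) by (simp add: nn_integral_cmult_indicator)
  also have "\<dots> \<le> (\<integral>\<^sup>+x. epow (f x) ?p \<partial>M)"
    using f p1 by (intro nn_integral_mono) (auto simp: indicator_def intro: epow_mono)
  finally have "epow (epow m ?p * ennreal \<eta>) (1 / ?p) \<le> epow (\<integral>\<^sup>+x. epow (f x) ?p \<partial>M) (1 / ?p)"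
    by (rule epow_mono) (use p1 in auto)
  then show ?thesis
    using p1 False E by (simp add: epow_mult epow_epow epow_ennreal Lp_norm_finite_exp)
qed

section \<open>The dyadic differences of the ball mass\<close>

text \<open>
  The coefficients of the polynomial \<open>(1 - z)(1 - 2z) \<dots> (1 - 2\<^sup>kz)\<close>, where \<open>z\<close> stands for the
  dilation \<open>F(r) \<mapsto> F(r/2)\<close>.
\<close>

primrec dyadic_coeff :: "nat \<Rightarrow> nat \<Rightarrow> real" where
  "dyadic_coeff 0 m = (if m = 0 then 1 else if m = 1 then -1 else 0)"
| "dyadic_coeff (Suc k) m =
     dyadic_coeff k m - 2 ^ (k + 1) * (case m of 0 \<Rightarrow> 0 | Suc l \<Rightarrow> dyadic_coeff k l)"

lemma dyadic_coeff_eq_0: "k + 1 < m \<Longrightarrow> dyadic_coeff k m = 0"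
  by (induction k arbitrary: m) (auto split: nat.split)

lemma dyadic_coeff_top_nonzero: "dyadic_coeff k (k + 1) \<noteq> 0"
  by (induction k) (auto simp: dyadic_coeff_eq_0)

lemma dyadic_diff_eq_sum:
  "dyadic_diff k F r = (\<Sum>m\<le>k + 1. dyadic_coeff k m * F (r / 2 ^ m))"
proof (induction k arbitrary: r)
  case (Suc k)
  have "dyadic_diff (Suc k) F r = (\<Sum>m\<le>k + 1. dyadic_coeff k m * F (r / 2 ^ m))
     - 2 ^ (k + 1) * (\<Sum>m\<le>k + 1. dyadic_coeff k m * F (r / 2 ^ Suc m))"
    by (simp add: Suc divide_divide_eq_left mult.commute del: sum.atMost_Suc)
  also have "(\<Sum>m\<le>k + 1. dyadic_coeff k m * F (r / 2 ^ m)) = (\<Sum>m\<le>k + 2. dyadic_coeff k m * F (r / 2 ^ m))"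
    by (simp add: dyadic_coeff_eq_0)
  also have "(\<Sum>m\<le>k + 1. dyadic_coeff k m * F (r / 2 ^ Suc m))
      = (\<Sum>m\<le>k + 2. (case m of 0 \<Rightarrow> 0 | Suc l \<Rightarrow> dyadic_coeff k l) * F (r / 2 ^ m))"
    using sum.atMost_Suc_shift[of "\<lambda>m. (case m of 0 \<Rightarrow> 0 | Suc l \<Rightarrow> dyadic_coeff k l) * F (r / 2 ^ m)" "k + 1"]
    by (simp del: sum.atMost_Suc)
  finally show ?case
    by (simp add: sum_distrib_left sum_subtractf[symmetric] algebra_simps del: sum.atMost_Suc)
qed auto

text \<open>
  The factor \<open>1 - z\<close> vanishes at \<open>z = 1\<close>: already the first difference annihilates constants.
\<close>

lemma sum_dyadic_coeff: "(\<Sum>m\<le>k + 1. dyadic_coeff k m) = 0"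
proof -
  have "dyadic_diff k (\<lambda>_. 1) r = 0" for r by (induction k arbitrary: r) auto
  then show ?thesis using dyadic_diff_eq_sum[of k "\<lambda>_. 1"] by simp
qed

lemma ball_mass_nonneg [simp]: "0 \<le> ball_mass \<mu> r y"
  by (simp add: ball_mass_def)

lemma measurable_ball_mass:
  fixes \<mu> :: "'a::euclidean_space measure"
  assumes "finite_measure \<mu>" and s: "sets \<mu> = sets borel"
  shows "(\<lambda>z. ball_mass \<mu> (fst z) (snd z)) \<in> borel_measurable borel"
proof -
  interpret finite_measure \<mu> by fact
  let ?A = "{z :: (real \<times> 'a) \<times> 'a. norm (snd z - snd (fst z)) \<le> fst (fst z)}"
  have "closed ?A" by (intro closed_Collect_le continuous_intros)
  then have "?A \<in> sets (borel \<Otimes>\<^sub>M borel)" unfolding borel_prod by auto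
  also have "sets (borel \<Otimes>\<^sub>M borel) = sets ((borel :: (real \<times> 'a) measure) \<Otimes>\<^sub>M \<mu>)"
    using s by (intro sets_pair_measure_cong) auto
  finally have "(\<lambda>z. emeasure \<mu> (Pair z -` ?A)) \<in> borel_measurable borel"
    by (rule measurable_emeasure_Pair)
  then show ?thesis
    unfolding ball_mass_def measure_def by (simp add: vimage_def)
qed

lemma borel_measurable_ball_mass[measurable (raw)]:
  fixes \<mu> :: "'a::euclidean_space measure"
  assumes "finite_measure \<mu>" "sets \<mu> = sets borel" "f \<in> borel_measurable M" "g \<in> borel_measurable M"
  shows "(\<lambda>z. ball_mass \<mu> (f z) (g z)) \<in> borel_measurable M"
  using measurable_compose[OF _ measurable_ball_mass[OF assms(1,2)], of "\<lambda>z. (f z, g z)" M] assms(3,4)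
  by (simp add: borel_prod[symmetric])

text \<open>
  The inner norm of the small ball norm, as a function of the centre \<open>y\<close>.
\<close>

definition sbe_profile :: "real \<Rightarrow> ennreal \<Rightarrow> nat \<Rightarrow> 'a::euclidean_space measure \<Rightarrow> 'a \<Rightarrow> ennreal" where
  "sbe_profile \<alpha> p k \<mu> y = Lp_norm dr_over_r p (\<lambda>r.
     ennreal \<bar>r powr (- \<alpha> - real DIM('a)) * dyadic_diff k (\<lambda>s. ball_mass \<mu> s y) r\<bar>)"

lemma sbe_norm_eq_profile:
  "sbe_norm \<alpha> p q (\<mu> :: 'a::euclidean_space measure)
    = Lp_norm lborel q (sbe_profile \<alpha> p (nat \<lceil>\<alpha> + real DIM('a) - 1\<rceil>) \<mu>)"
  by (simp add: sbe_norm_def sbe_profile_def[abs_def] Let_def)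

lemma sets_dr_over_r[measurable_cong, simp]: "sets dr_over_r = sets borel"
  by (simp add: dr_over_r_def)

lemma nn_integral_dr_over_r:
  assumes [measurable]: "f \<in> borel_measurable borel"
  shows "(\<integral>\<^sup>+r. f r \<partial>dr_over_r) = (\<integral>\<^sup>+r. (if 0 < r then ennreal (1 / r) else 0) * f r \<partial>lborel)"
  unfolding dr_over_r_def by (subst nn_integral_density) auto

lemma borel_measurable_sbe_profile:
  fixes \<mu> :: "'a::euclidean_space measure"
  assumes [measurable]: "finite_measure \<mu>" "sets \<mu> = sets borel" and p: "p \<noteq> \<infinity>"
  shows "sbe_profile \<alpha> p k \<mu> \<in> borel_measurable borel"
proof -
  note [measurable (raw)] = borel_measurable_ball_mass[OF assms(1,2)]
  have "(\<lambda>y. \<integral>\<^sup>+r. (if 0 < r then ennreal (1 / r) else 0) *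
      epow (ennreal \<bar>r powr (- \<alpha> - real DIM('a)) * dyadic_diff k (\<lambda>s. ball_mass \<mu> s y) r\<bar>) (enn2real p) \<partial>lborel)
      \<in> borel_measurable borel"
    unfolding dyadic_diff_eq_sum by measurable
  then have "(\<lambda>y. \<integral>\<^sup>+r. epow (ennreal \<bar>r powr (- \<alpha> - real DIM('a)) * dyadic_diff k (\<lambda>s. ball_mass \<mu> s y) r\<bar>)
       (enn2real p) \<partial>dr_over_r) \<in> borel_measurable borel"
    by (subst nn_integral_dr_over_r) (simp_all add: dyadic_diff_eq_sum)
  then show ?thesis
    unfolding sbe_profile_def[abs_def] Lp_norm_finite_exp[OF p] by measurable
qed

section \<open>Gaussian averages of ball masses\<close>

text \<open>
  Minus the derivative of \<open>exp (- (r/s)\<^sup>2/2)\<close> on the positive half line.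
\<close>

definition gauss_slope :: "real \<Rightarrow> real \<Rightarrow> real" where
  "gauss_slope s r = (if 0 < r then r / s\<^sup>2 * exp (- (r / s)\<^sup>2 / 2) else 0)"

lemma gauss_slope_nonneg: "0 \<le> gauss_slope s r"
  by (simp add: gauss_slope_def)

lemma borel_measurable_gauss_slope[measurable]: "gauss_slope s \<in> borel_measurable borel"
  unfolding gauss_slope_def by measurable

lemma gauss_slope_tail:
  assumes s: "0 < s" and \<rho>: "0 \<le> \<rho>"
  shows "(\<integral>\<^sup>+r. ennreal (gauss_slope s r) * indicator {\<rho>..} r \<partial>lborel) = ennreal (exp (- (\<rho> / s)\<^sup>2 / 2))"
proof -
  have lim: "((\<lambda>r. - exp (- (r / s)\<^sup>2 / 2)) \<longlongrightarrow> 0) at_top"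
    using s by real_asymp
  have "(\<integral>\<^sup>+r. ennreal (gauss_slope s r) * indicator {\<rho>..} r \<partial>lborel)
     = ennreal (0 - (- exp (- (\<rho> / s)\<^sup>2 / 2)))"
  proof (rule nn_integral_FTC_atLeast[OF _ _ _ lim])
    fix r assume "\<rho> \<le> r"
    then have "0 \<le> r" using \<rho> by simp
    then show "((\<lambda>r. - exp (- (r / s)\<^sup>2 / 2)) has_real_derivative gauss_slope s r) (at r)"
      using s by (auto intro!: derivative_eq_intros simp: gauss_slope_def power2_eq_square field_simps)
  qed (auto simp: gauss_slope_nonneg)
  then show ?thesis by simp
qed

text \<open>
  Layer cake formula: the Gaussian of \<open>2\<^sup>m\<bar>x - y\<bar>\<close> is the integral of \<open>gauss_slope s\<close> over the
  radii \<open>r\<close> with \<open>\<bar>x - y\<bar> \<le> r/2\<^sup>m\<close>, and Tonelli's theorem exchanges the integrations over \<open>r\<close>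
  and \<open>\<mu>\<close>.
\<close>

lemma gauss_average_eq_ball_mass_integral:
  fixes \<mu> :: "'a::euclidean_space measure"
  assumes fin: "finite_measure \<mu>" and sets[measurable_cong]: "sets \<mu> = sets borel" and s: "0 < s"
  shows "(\<integral>\<^sup>+r. ennreal (gauss_slope s r * ball_mass \<mu> (r / 2 ^ m) y) \<partial>lborel)
       = (\<integral>\<^sup>+x. ennreal (exp (- (2 ^ m * norm (x - y) / s)\<^sup>2 / 2)) \<partial>\<mu>)"
proof -
  interpret \<mu>: finite_measure \<mu> by (rule fin)
  interpret pair_sigma_finite lborel \<mu> by standard
  have set: "{x. norm (x - y) \<le> r / 2 ^ m} \<in> sets \<mu>" for r
    unfolding sets by measurable
  have "ennreal (ball_mass \<mu> (r / 2 ^ m) y) = (\<integral>\<^sup>+x. indicator {2 ^ m * norm (x - y)..} r \<partial>\<mu>)" for r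
  proof -
    have "ennreal (ball_mass \<mu> (r / 2 ^ m) y) = (\<integral>\<^sup>+x. indicator {x. norm (x - y) \<le> r / 2 ^ m} x \<partial>\<mu>)"
      unfolding ball_mass_def using set by (simp add: \<mu>.emeasure_eq_measure)
    then show ?thesis
      by (simp add: indicator_def field_simps)
  qed
  moreover have "(\<lambda>x. indicator {2 ^ m * norm (x - y)..} r :: ennreal) \<in> borel_measurable \<mu>" for r :: real
    unfolding indicator_def atLeast_iff by measurable
  ultimately have "(\<integral>\<^sup>+r. ennreal (gauss_slope s r * ball_mass \<mu> (r / 2 ^ m) y) \<partial>lborel)
     = (\<integral>\<^sup>+r. (\<integral>\<^sup>+x. ennreal (gauss_slope s r) * indicator {2 ^ m * norm (x - y)..} r \<partial>\<mu>) \<partial>lborel)"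
    by (simp add: ennreal_mult gauss_slope_nonneg nn_integral_cmult)
  also have "\<dots> = (\<integral>\<^sup>+x. (\<integral>\<^sup>+r. ennreal (gauss_slope s r) * indicator {2 ^ m * norm (x - y)..} r \<partial>lborel) \<partial>\<mu>)"
    unfolding indicator_def atLeast_iff by (rule Fubini'[symmetric]) measurable
  also have "\<dots> = (\<integral>\<^sup>+x. ennreal (exp (- (2 ^ m * norm (x - y) / s)\<^sup>2 / 2)) \<partial>\<mu>)"
    by (simp add: gauss_slope_tail[OF s])
  finally show ?thesis .
qed

definition gauss_kernel :: "nat \<Rightarrow> 'a::euclidean_space \<Rightarrow> real" where
  "gauss_kernel k z = (\<Sum>m\<le>k + 1. dyadic_coeff k m * exp (- (2 ^ m * norm z)\<^sup>2 / 2))"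

lemma borel_measurable_gauss_kernel[measurable]: "gauss_kernel k \<in> borel_measurable borel"
  unfolding gauss_kernel_def by measurable

lemma gauss_kernel_average:
  fixes \<mu> :: "'a::euclidean_space measure"
  assumes fin: "finite_measure \<mu>" and sets[measurable_cong]: "sets \<mu> = sets borel" and s: "0 < s"
  shows "(\<integral>x. gauss_kernel k ((1 / s) *\<^sub>R (y - x)) \<partial>\<mu>)
      = (\<integral>r. gauss_slope s r * dyadic_diff k (\<lambda>s. ball_mass \<mu> s y) r \<partial>lborel)"
proof -
  interpret \<mu>: finite_measure \<mu> by (rule fin)
  note [measurable (raw)] = borel_measurable_ball_mass[OF fin sets]
  define e where "e m x = exp (- (2 ^ m * norm (x - y) / s)\<^sup>2 / 2)" for m x
  have e_nonneg: "0 \<le> e m x" for m x by (simp add: e_def)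
  have int_e: "integrable \<mu> (e m)" for m
    unfolding e_def by (rule \<mu>.integrable_const_bound[where B = 1]) auto
  have nn: "(\<integral>\<^sup>+x. ennreal (e m x) \<partial>\<mu>) = ennreal (\<integral>x. e m x \<partial>\<mu>)" for m
    by (rule nn_integral_eq_integral[OF int_e]) (auto simp: e_def)
  have i: "integrable lborel (\<lambda>r. gauss_slope s r * ball_mass \<mu> (r / 2 ^ m) y)" for m
  proof (rule integrableI_nonneg)
    show "(\<integral>\<^sup>+r. ennreal (gauss_slope s r * ball_mass \<mu> (r / 2 ^ m) y) \<partial>lborel) < \<infinity>"
      unfolding gauss_average_eq_ball_mass_integral[OF fin sets s] e_def[symmetric] nn by simp
  qed (auto simp: gauss_slope_nonneg)
  have v: "(\<integral>r. gauss_slope s r * ball_mass \<mu> (r / 2 ^ m) y \<partial>lborel) = (\<integral>x. e m x \<partial>\<mu>)" for m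
    using gauss_average_eq_ball_mass_integral[OF fin sets s, of m y] nn[of m] unfolding e_def[symmetric]
    by (subst integral_eq_nn_integral)
      (auto simp: gauss_slope_nonneg e_nonneg)
  have "(\<integral>r. gauss_slope s r * dyadic_diff k (\<lambda>s. ball_mass \<mu> s y) r \<partial>lborel)
     = (\<integral>r. (\<Sum>m\<le>k + 1. dyadic_coeff k m * (gauss_slope s r * ball_mass \<mu> (r / 2 ^ m) y)) \<partial>lborel)"
    unfolding dyadic_diff_eq_sum sum_distrib_left by (simp add: mult_ac del: sum.atMost_Suc)
  also have "\<dots> = (\<Sum>m\<le>k + 1. dyadic_coeff k m * (\<integral>x. e m x \<partial>\<mu>))"
    by (subst Bochner_Integration.integral_sum) (auto simp: i v simp del: sum.atMost_Suc)
  also have "\<dots> = (\<integral>x. (\<Sum>m\<le>k + 1. dyadic_coeff k m * e m x) \<partial>\<mu>)"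
    by (subst Bochner_Integration.integral_sum)
      (simp_all add: int_e del: sum.atMost_Suc)
  also have "\<dots> = (\<integral>x. gauss_kernel k ((1 / s) *\<^sub>R (y - x)) \<partial>\<mu>)"
    unfolding gauss_kernel_def e_def using s by (simp add: norm_minus_commute del: sum.atMost_Suc)
  finally show ?thesis by simp
qed

text \<open>
  The two bounds make the radial weight below integrable with respect to \<open>dr/r\<close> and bounded.
\<close>

lemma powr_gauss_bound:
  assumes "0 < (\<gamma>::real)"
  shows "\<exists>B>0. \<forall>u>0. u powr \<gamma> * exp (- u\<^sup>2 / 2) \<le> B / (1 + u\<^sup>2) \<and> u * u powr \<gamma> * exp (- u\<^sup>2 / 2) \<le> B"
proof -
  have "((\<lambda>u. u powr \<gamma> * (1 + u + u\<^sup>2) * exp (- u\<^sup>2 / 2)) \<longlongrightarrow> 0) at_top"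
    by real_asymp
  then have "eventually (\<lambda>u. u powr \<gamma> * (1 + u + u\<^sup>2) * exp (- u\<^sup>2 / 2) < 1) at_top"
    by (rule order_tendstoD) simp
  then obtain N where N: "\<And>u. N \<le> u \<Longrightarrow> u powr \<gamma> * (1 + u + u\<^sup>2) * exp (- u\<^sup>2 / 2) < 1"
    by (auto simp: eventually_at_top_linorder)
  define B where "B = max 1 (N powr \<gamma> * (1 + N + N\<^sup>2))"
  have "u powr \<gamma> * (1 + u + u\<^sup>2) * exp (- u\<^sup>2 / 2) \<le> B" if u: "0 < u" for u
  proof (cases "N \<le> u")
    case True
    then show ?thesis using N[of u] by (simp add: B_def)
  next
    case False
    have "u powr \<gamma> * (1 + u + u\<^sup>2) * exp (- u\<^sup>2 / 2) \<le> N powr \<gamma> * (1 + N + N\<^sup>2) * 1"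
      using False u assms by (intro mult_mono powr_mono2 add_mono power_mono mult_nonneg_nonneg) auto
    then show ?thesis by (simp add: B_def)
  qed
  then have B: "u powr \<gamma> * (1 + u + u\<^sup>2) * exp (- u\<^sup>2 / 2) \<le> B" if "0 < u" for u
    using that by blast
  have "u powr \<gamma> * exp (- u\<^sup>2 / 2) \<le> B / (1 + u\<^sup>2) \<and> u * u powr \<gamma> * exp (- u\<^sup>2 / 2) \<le> B" if u: "0 < u" for u
  proof -
    define a where "a = u powr \<gamma> * exp (- u\<^sup>2 / 2)"
    have "a + u * a + u\<^sup>2 * a \<le> B" using B[OF u] by (simp add: a_def algebra_simps)
    moreover have "0 \<le> a" "0 \<le> u * a" "0 \<le> u\<^sup>2 * a" using u by (auto simp: a_def)
    ultimately have "a + u\<^sup>2 * a \<le> B" "u * a \<le> B" by linarith+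
    then have "a * (1 + u\<^sup>2) \<le> B" "u * a \<le> B" by (simp_all add: algebra_simps)
    moreover have "0 < 1 + u\<^sup>2" by (simp add: add_pos_nonneg)
    ultimately show ?thesis unfolding a_def by (simp add: pos_le_divide_eq mult.assoc)
  qed
  then show ?thesis by (intro exI[of _ B]) (auto simp: B_def)
qed

text \<open>
  Written with respect to \<open>dr/r\<close>, the average pairs \<open>\<bar>r\<^sup>-\<^sup>\<beta> \<Delta>\<^sub>kF(r, y)\<bar>\<close>, \<open>\<beta> = \<alpha> + d\<close>, with
  \<open>s\<^sup>\<beta> V(r/s)\<close>, where \<open>V(u) = u\<^sup>\<beta>\<^sup>+\<^sup>2 exp (- u\<^sup>2/2)\<close>. The measure \<open>dr/r\<close> is invariant
  under dilations, so the mass of \<open>V(r/s)\<close> does not depend on \<open>s\<close>.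
\<close>

lemma gauss_kernel_average_le_profile:
  fixes p :: ennreal and \<alpha> :: real
  assumes p: "1 \<le> p" "p \<noteq> \<infinity>" and \<alpha>: "0 < \<alpha>"
  shows "\<exists>C>0. \<forall>(\<mu> :: 'a::euclidean_space measure) s y. finite_measure \<mu> \<longrightarrow> sets \<mu> = sets borel \<longrightarrow> 0 < s \<longrightarrow>
     ennreal \<bar>\<integral>x. gauss_kernel k ((1 / s) *\<^sub>R (y - x)) \<partial>\<mu>\<bar>
       \<le> ennreal (C * s powr (\<alpha> + real DIM('a))) * sbe_profile \<alpha> p k \<mu> y"
proof -
  define \<beta> where "\<beta> = \<alpha> + real DIM('a)"
  have \<beta>: "0 < \<beta>" using \<alpha> by (simp add: \<beta>_def)
  obtain B where B: "0 < B" "\<And>u. 0 < u \<Longrightarrow> u powr (\<beta> + 1) * exp (- u\<^sup>2 / 2) \<le> B / (1 + u\<^sup>2)"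
    "\<And>u. 0 < u \<Longrightarrow> u * u powr (\<beta> + 1) * exp (- u\<^sup>2 / 2) \<le> B"
    using powr_gauss_bound[of "\<beta> + 1"] \<beta> by auto
  define V where "V u = (if 0 < u then u * u powr (\<beta> + 1) * exp (- u\<^sup>2 / 2) else 0)" for u :: real
  have [measurable]: "V \<in> borel_measurable borel" unfolding V_def by measurable
  have V: "0 \<le> V u" "V u \<le> B" for u using B by (auto simp: V_def)
  have int: "(\<integral>\<^sup>+r. ennreal (V (r / s)) \<partial>dr_over_r) \<le> ennreal (B * pi)" if s: "0 < s" for s
  proof -
    have "(\<integral>\<^sup>+r. ennreal (V (r / s)) \<partial>dr_over_r)
       = (\<integral>\<^sup>+r. (if 0 < r then ennreal (1 / r) else 0) * ennreal (V (r / s)) \<partial>lborel)"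
      by (rule nn_integral_dr_over_r) measurable
    also have "\<dots> = ennreal s * (\<integral>\<^sup>+u. (if 0 < s * u then ennreal (1 / (s * u)) else 0) * ennreal (V (s * u / s)) \<partial>lborel)"
      using nn_integral_real_affine[of "\<lambda>r. (if 0 < r then ennreal (1 / r) else 0) * ennreal (V (r / s))" s 0] s
      by (simp cong: if_cong)
    also have "\<dots> = (\<integral>\<^sup>+u. ennreal s * ((if 0 < s * u then ennreal (1 / (s * u)) else 0) * ennreal (V (s * u / s))) \<partial>lborel)"
      by (rule nn_integral_cmult[symmetric]) measurable
    also have "\<dots> \<le> (\<integral>\<^sup>+u. ennreal B * ennreal (inverse (1 + u\<^sup>2)) \<partial>lborel)"
    proof (intro nn_integral_mono)
      fix u :: real
      show "ennreal s * ((if 0 < s * u then ennreal (1 / (s * u)) else 0) * ennreal (V (s * u / s)))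
          \<le> ennreal B * ennreal (inverse (1 + u\<^sup>2))"
      proof (cases "0 < u")
        case True
        have "s * (1 / (s * u) * V u) = u powr (\<beta> + 1) * exp (- u\<^sup>2 / 2)"
          using True s by (simp add: V_def)
        also have "\<dots> \<le> B * inverse (1 + u\<^sup>2)"
          using B(2)[OF True] by (simp only: divide_inverse)
        finally have le: "s * (1 / (s * u) * V u) \<le> B * inverse (1 + u\<^sup>2)" .
        have "ennreal s * (ennreal (1 / (s * u)) * ennreal (V u)) = ennreal (s * (1 / (s * u) * V u))"
          using True s V[of u] by (simp only: ennreal_mult mult_nonneg_nonneg divide_nonneg_nonneg less_imp_le zero_le_one)
        also have "\<dots> \<le> ennreal (B * inverse (1 + u\<^sup>2))"
          by (rule ennreal_leI[OF le])
        also have "\<dots> = ennreal B * ennreal (inverse (1 + u\<^sup>2))"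
          using B(1) by (simp add: ennreal_mult)
        finally show ?thesis using True s by simp
      qed (use s in \<open>auto simp: zero_less_mult_iff\<close>)
    qed
    also have "\<dots> = ennreal (B * pi)"
      using B by (simp add: nn_integral_cmult nn_integral_inverse_1_plus_sq ennreal_mult)
    finally show ?thesis .
  qed
  define C where "C = ((B * pi) powr (enn2real p - 1) * B) powr (1 / enn2real p)"
  have "0 < C" using B by (simp add: C_def)
  moreover have "ennreal \<bar>\<integral>x. gauss_kernel k ((1 / s) *\<^sub>R (y - x)) \<partial>\<mu>\<bar>
       \<le> ennreal (C * s powr \<beta>) * sbe_profile \<alpha> p k \<mu> y"
    if fin: "finite_measure \<mu>" and sets: "sets \<mu> = sets borel" and s: "0 < s"
    for \<mu> :: "'a measure" and s y
  proof -
    note [measurable (raw)] = borel_measurable_ball_mass[OF fin sets]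
    define f where "f r = \<bar>r powr (- \<beta>) * dyadic_diff k (\<lambda>s. ball_mass \<mu> s y) r\<bar>" for r
    have [measurable]: "f \<in> borel_measurable borel"
      unfolding f_def dyadic_diff_eq_sum by measurable
    have prof: "sbe_profile \<alpha> p k \<mu> y = Lp_norm dr_over_r p (\<lambda>r. ennreal (f r))"
      unfolding sbe_profile_def f_def \<beta>_def by simp
    have "ennreal \<bar>\<integral>x. gauss_kernel k ((1 / s) *\<^sub>R (y - x)) \<partial>\<mu>\<bar>
       \<le> (\<integral>\<^sup>+r. ennreal \<bar>gauss_slope s r * dyadic_diff k (\<lambda>s. ball_mass \<mu> s y) r\<bar> \<partial>lborel)"
      unfolding gauss_kernel_average[OF fin sets s]
      using integral_norm_bound_ennreal[of lborel "\<lambda>r. gauss_slope s r * dyadic_diff k (\<lambda>s. ball_mass \<mu> s y) r"]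
      by (cases "integrable lborel (\<lambda>r. gauss_slope s r * dyadic_diff k (\<lambda>s. ball_mass \<mu> s y) r)")
        (auto simp: not_integrable_integral_eq)
    also have "\<dots> = (\<integral>\<^sup>+r. (if 0 < r then ennreal (1 / r) else 0) *
         (ennreal (s powr \<beta>) * (ennreal (V (r / s)) * ennreal (f r))) \<partial>lborel)"
    proof (intro nn_integral_cong)
      fix r :: real
      show "ennreal \<bar>gauss_slope s r * dyadic_diff k (\<lambda>s. ball_mass \<mu> s y) r\<bar>
        = (if 0 < r then ennreal (1 / r) else 0) * (ennreal (s powr \<beta>) * (ennreal (V (r / s)) * ennreal (f r)))"
      proof (cases "0 < r")
        case True
        let ?D = "\<bar>dyadic_diff k (\<lambda>s. ball_mass \<mu> s y) r\<bar>"
        have "1 / r * (s powr \<beta> * (V (r / s) * f r)) = gauss_slope s r * ?D *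
            (s powr \<beta> * (r / s) powr \<beta> * r powr (- \<beta>))"
          using True s by (simp add: V_def f_def gauss_slope_def abs_mult powr_add power2_eq_square field_simps)
        also have "s powr \<beta> * (r / s) powr \<beta> * r powr (- \<beta>) = 1"
          using True s by (simp add: powr_divide powr_minus)
        finally have "\<bar>gauss_slope s r * dyadic_diff k (\<lambda>s. ball_mass \<mu> s y) r\<bar> = 1 / r * (s powr \<beta> * (V (r / s) * f r))"
          by (simp add: abs_mult gauss_slope_nonneg)
        moreover have "0 \<le> f r" by (simp add: f_def)
        then have "ennreal (1 / r * (s powr \<beta> * (V (r / s) * f r)))
          = ennreal (1 / r) * (ennreal (s powr \<beta>) * (ennreal (V (r / s)) * ennreal (f r)))"
          using True V[of "r / s"]
          by (simp only: ennreal_mult mult_nonneg_nonneg divide_nonneg_nonneg less_imp_le zero_le_one powr_ge_zero)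
        ultimately show ?thesis using True by simp
      qed (simp add: gauss_slope_def)
    qed
    also have "\<dots> = (\<integral>\<^sup>+r. ennreal (s powr \<beta>) * (ennreal (V (r / s)) * ennreal (f r)) \<partial>dr_over_r)"
      by (rule nn_integral_dr_over_r[symmetric]) measurable
    also have "\<dots> = ennreal (s powr \<beta>) * (\<integral>\<^sup>+r. ennreal (V (r / s)) * ennreal (f r) \<partial>dr_over_r)"
      by (rule nn_integral_cmult) measurable
    also have "\<dots> \<le> ennreal (s powr \<beta>) * (ennreal C * Lp_norm dr_over_r p (\<lambda>r. ennreal (f r)))"
      unfolding C_def
      by (intro mult_left_mono weighted_integral_le_Lp_norm p int s)
        (use B V in \<open>auto intro: ennreal_leI\<close>)
    also have "\<dots> = ennreal (C * s powr \<beta>) * sbe_profile \<alpha> p k \<mu> y"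
      using \<open>0 < C\<close> by (simp add: prof ennreal_mult mult_ac)
    finally show ?thesis .
  qed
  ultimately show ?thesis unfolding \<beta>_def by blast
qed

section \<open>Absolute convergence on product spaces\<close>

lemma (in pair_sigma_finite) integrable_product_bound:
  fixes f :: "'a \<times> 'b \<Rightarrow> 'c::{banach, second_countable_topology}" and g :: "'a \<Rightarrow> real" and h :: "'b \<Rightarrow> real"
  assumes [measurable]: "f \<in> borel_measurable (M1 \<Otimes>\<^sub>M M2)" and g: "integrable M1 g" and h: "integrable M2 h"
    and bd: "\<And>x y. norm (f (x, y)) \<le> \<bar>g x\<bar> * \<bar>h y\<bar>"
  shows "integrable (M1 \<Otimes>\<^sub>M M2) f"
proof -
  have [measurable]: "g \<in> borel_measurable M1" "h \<in> borel_measurable M2" using g h by auto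
  have "(\<integral>\<^sup>+z. ennreal (norm (f z)) \<partial>(M1 \<Otimes>\<^sub>M M2)) = (\<integral>\<^sup>+x. (\<integral>\<^sup>+y. ennreal (norm (f (x, y))) \<partial>M2) \<partial>M1)"
    by (rule M2.nn_integral_fst[symmetric]) measurable
  also have "\<dots> \<le> (\<integral>\<^sup>+x. (\<integral>\<^sup>+y. ennreal \<bar>g x\<bar> * ennreal \<bar>h y\<bar> \<partial>M2) \<partial>M1)"
    using bd by (intro nn_integral_mono) (simp add: ennreal_mult[symmetric] ennreal_leI)
  also have "\<dots> = (\<integral>\<^sup>+x. ennreal \<bar>g x\<bar> \<partial>M1) * (\<integral>\<^sup>+y. ennreal \<bar>h y\<bar> \<partial>M2)"
    by (simp add: nn_integral_cmult nn_integral_multc)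
  also have "\<dots> < \<infinity>"
    using g h by (simp add: integrable_iff_bounded ennreal_mult_less_top)
  finally show ?thesis by (simp add: integrable_iff_bounded)
qed

section \<open>The Fourier transform of the Gaussian kernel\<close>

definition gauss_symbol :: "nat \<Rightarrow> 'a::euclidean_space \<Rightarrow> real" where
  "gauss_symbol k \<xi> = (\<Sum>m\<le>k + 1. dyadic_coeff k m *
     (sqrt (2 * pi / 4 ^ m) ^ DIM('a) * exp (- (norm \<xi>)\<^sup>2 / (2 * 4 ^ m))))"

lemma gauss_kernel_eq: "gauss_kernel k z = (\<Sum>m\<le>k + 1. dyadic_coeff k m * exp (- (4 ^ m / 2) * (norm z)\<^sup>2))"
  unfolding gauss_kernel_def
  by (intro sum.cong refl) (simp add: power_mult_distrib power_mult[symmetric] power_even_eq[symmetric] mult.commute[of 2] power2_eq_square power_mult_distrib[symmetric])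

lemma gauss_kernel_fourier:
  fixes \<xi> :: "'a::euclidean_space"
  shows "integrable lborel (gauss_kernel k :: 'a \<Rightarrow> real)"
    and "(\<integral>z. gauss_kernel k z *\<^sub>R cis (z \<bullet> \<xi>) \<partial>lborel) = of_real (gauss_symbol k \<xi>)"
proof -
  define g where "g m z = exp (- (4 ^ m / 2) * (norm z)\<^sup>2)" for m :: nat and z :: 'a
  have i: "integrable lborel (g m)" for m :: nat
    unfolding g_def by (rule gaussian_fourier(1)) simp
  have i': "integrable lborel (\<lambda>z. g m z *\<^sub>R cis (z \<bullet> \<xi>))" for m :: nat
    by (rule Bochner_Integration.integrable_bound[OF i[of m]]) (auto simp: g_def)
  show "integrable lborel (gauss_kernel k :: 'a \<Rightarrow> real)"
    unfolding gauss_kernel_eq[abs_def] g_def[symmetric]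
    by (intro Bochner_Integration.integrable_sum integrable_mult_right i)
  have v: "(\<integral>z. g m z *\<^sub>R cis (z \<bullet> \<xi>) \<partial>lborel) =
      of_real (sqrt (2 * pi / 4 ^ m) ^ DIM('a) * exp (- (norm \<xi>)\<^sup>2 / (2 * 4 ^ m)))" for m :: nat
    unfolding g_def by (subst gaussian_fourier(2)) (simp_all add: mult.commute)
  have "(\<integral>z. gauss_kernel k z *\<^sub>R cis (z \<bullet> \<xi>) \<partial>lborel)
     = (\<integral>z. (\<Sum>m\<le>k + 1. dyadic_coeff k m *\<^sub>R (g m z *\<^sub>R cis (z \<bullet> \<xi>))) \<partial>lborel)"
    unfolding gauss_kernel_eq g_def scaleR_sum_left by (simp del: sum.atMost_Suc)
  also have "\<dots> = (\<Sum>m\<le>k + 1. dyadic_coeff k m *\<^sub>R (\<integral>z. g m z *\<^sub>R cis (z \<bullet> \<xi>) \<partial>lborel))"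
    by (subst Bochner_Integration.integral_sum) (simp_all add: i' del: sum.atMost_Suc scaleR_scaleR)
  also have "\<dots> = of_real (gauss_symbol k \<xi>)"
    unfolding v gauss_symbol_def by (simp add: scaleR_conv_of_real del: sum.atMost_Suc)
  finally show "(\<integral>z. gauss_kernel k z *\<^sub>R cis (z \<bullet> \<xi>) \<partial>lborel) = of_real (gauss_symbol k \<xi>)" .
qed

lemma gauss_kernel_bounded: "\<exists>C. \<forall>z. \<bar>gauss_kernel k z\<bar> \<le> C"
proof (intro exI allI)
  fix z :: 'a
  show "\<bar>gauss_kernel k z\<bar> \<le> (\<Sum>m\<le>k + 1. \<bar>dyadic_coeff k m\<bar>)"
    unfolding gauss_kernel_def
    by (rule order_trans[OF sum_abs], rule sum_mono) (auto intro!: mult_left_le simp: abs_mult)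
qed

text \<open>
  After division by the slowest Gaussian, that of \<open>m = k + 1\<close>, all other terms tend to zero at
  infinity, while its own coefficient is not zero.
\<close>

lemma gauss_symbol_nonzero:
  "\<exists>\<sigma>>0. \<forall>\<xi>::'a::euclidean_space. 1 / 4 < norm \<xi> \<longrightarrow> gauss_symbol k (\<sigma> *\<^sub>R \<xi>) \<noteq> 0"
proof -
  define n where "n = k + 1"
  define w where "w m = dyadic_coeff k m * sqrt (2 * pi / 4 ^ m) ^ DIM('a)" for m
  define h where "h \<tau> = (\<Sum>m\<le>n. w m * exp (- \<tau> * (1 / (2 * 4 ^ m) - 1 / (2 * 4 ^ n))))" for \<tau> :: real
  have "(h \<longlongrightarrow> (\<Sum>m\<le>n. if m = n then w n else 0)) at_top"
    unfolding h_def
  proof (intro tendsto_sum)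
    fix m assume "m \<in> {..n}"
    show "((\<lambda>\<tau>. w m * exp (- \<tau> * (1 / (2 * 4 ^ m) - 1 / (2 * 4 ^ n)))) \<longlongrightarrow> (if m = n then w n else 0)) at_top"
    proof (cases "m = n")
      case False
      then have "(4::real) ^ m < 4 ^ n" using \<open>m \<in> {..n}\<close> by (intro power_strict_increasing) auto
      then have \<delta>: "0 < (1 / (2 * 4 ^ m) - 1 / (2 * 4 ^ n) :: real)" by (simp add: divide_strict_left_mono)
      have "((\<lambda>\<tau>. c * exp (- \<tau> * \<delta>)) \<longlongrightarrow> 0) at_top" if "0 < \<delta>" for c \<delta> :: real
        using that by real_asymp
      note this[OF \<delta>, of "w m"]
      then show ?thesis using False by simp
    qed simp
  qed
  then have "(h \<longlongrightarrow> w n) at_top" by simp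
  moreover have "w n \<noteq> 0" using dyadic_coeff_top_nonzero[of k] by (simp add: w_def n_def)
  ultimately have "eventually (\<lambda>\<tau>. h \<tau> \<noteq> 0) at_top" by (rule tendsto_imp_eventually_ne)
  then obtain T where T: "\<And>\<tau>. T \<le> \<tau> \<Longrightarrow> h \<tau> \<noteq> 0" by (auto simp: eventually_at_top_linorder)
  \<comment> \<open>Then \<open>\<bar>\<xi>\<bar> > 1/4\<close> implies \<open>\<bar>\<sigma> \<xi>\<bar>\<^sup>2 \<ge> T\<close>.\<close>
  define \<sigma> where "\<sigma> = 4 * sqrt (max T 1)"
  have l: "0 < \<sigma>" by (simp add: \<sigma>_def)
  have "gauss_symbol k (\<sigma> *\<^sub>R \<xi>) \<noteq> 0" if "1 / 4 < norm \<xi>" for \<xi> :: 'a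
  proof -
    have "sqrt (max T 1) \<le> norm (\<sigma> *\<^sub>R \<xi>)"
      using mult_left_mono[of "1 / 4" "norm \<xi>" \<sigma>] that l by (simp add: \<sigma>_def)
    then have "max T 1 \<le> (norm (\<sigma> *\<^sub>R \<xi>))\<^sup>2"
      using sqrt_le_D by blast
    then have "h ((norm (\<sigma> *\<^sub>R \<xi>))\<^sup>2) \<noteq> 0" by (intro T) simp
    moreover have "gauss_symbol k \<eta> = h ((norm \<eta>)\<^sup>2) * exp (- (norm \<eta>)\<^sup>2 / (2 * 4 ^ n))" for \<eta> :: 'a
      unfolding gauss_symbol_def h_def w_def n_def[symmetric] sum_distrib_right
      by (intro sum.cong refl) (simp add: mult.assoc exp_add[symmetric] right_diff_distrib)
    ultimately show ?thesis by simp
  qed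
  with l show ?thesis by blast
qed

lemma Cn_on_gauss_symbol: "Cn_on n UNIV (\<lambda>\<xi>::'a::euclidean_space. gauss_symbol k (\<sigma> *\<^sub>R \<xi>))"
proof -
  have "gauss_symbol k (\<sigma> *\<^sub>R \<xi>) = (\<Sum>m\<le>k + 1. dyadic_coeff k m *
     (sqrt (2 * pi / 4 ^ m) ^ DIM('a) * exp (- (\<sigma>\<^sup>2 / (2 * 4 ^ m)) * (norm \<xi>)\<^sup>2)))" for \<xi> :: 'a
    unfolding gauss_symbol_def by (simp add: power_mult_distrib del: sum.atMost_Suc)
  then show ?thesis
    by (simp only:) (intro Cn_on_sum Cn_on_mult Cn_on_const Cn_on_gaussian open_UNIV)
qed

section \<open>Dyadic blocks as convolutions with Gaussian averages\<close>

lemma borel_measurable_inv_fourier[measurable]: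
  assumes [measurable]: "m \<in> borel_measurable borel"
  shows "inv_fourier m \<in> borel_measurable borel"
  unfolding inv_fourier_def[abs_def] by measurable

lemma inv_fourier_eq_oscint: "inv_fourier m x = (1 / (2 * pi) ^ DIM('a)) *\<^sub>R oscint m x" for x :: "'a::euclidean_space"
  by (simp add: inv_fourier_def oscint_def)

text \<open>
  The inversion formula is avoided: inserting the integral that defines \<open>inv_fourier m\<close> and
  exchanging the integrations produces the Fourier transform of the kernel directly.
\<close>

lemma inv_fourier_mult_gauss_symbol:
  fixes m :: "'a::euclidean_space \<Rightarrow> real"
  assumes int: "integrable lborel m" and l: "0 < \<sigma>"
  shows "inv_fourier (\<lambda>\<xi>. m \<xi> * gauss_symbol k (\<sigma> *\<^sub>R \<xi>)) w
     = (1 / \<sigma> ^ DIM('a)) *\<^sub>R (\<integral>v. gauss_kernel k ((1 / \<sigma>) *\<^sub>R v) *\<^sub>R inv_fourier m (w - v) \<partial>lborel)"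
proof -
  let ?G = "\<lambda>v::'a. gauss_kernel k ((1 / \<sigma>) *\<^sub>R v)"
  have [measurable]: "m \<in> borel_measurable borel" using int by auto
  have G: "integrable lborel ?G"
    using integrable_lborel_affine[OF gauss_kernel_fourier(1), of "1 / \<sigma>" k 0] l by simp
  let ?f = "\<lambda>(v, \<xi>). ?G v *\<^sub>R (cis ((w - v) \<bullet> \<xi>) * of_real (m \<xi>))"
  have f: "integrable (lborel \<Otimes>\<^sub>M lborel) ?f"
    by (rule lborel_pair.integrable_product_bound[OF _ G int]) (auto simp: norm_mult)
  have "(\<integral>v. ?G v *\<^sub>R oscint m (w - v) \<partial>lborel) = (\<integral>v. (\<integral>\<xi>. ?f (v, \<xi>) \<partial>lborel) \<partial>lborel)"
    by (simp add: oscint_def)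
  also have "\<dots> = (\<integral>\<xi>. (\<integral>v. ?f (v, \<xi>) \<partial>lborel) \<partial>lborel)"
    by (rule lborel_pair.Fubini_integral[symmetric]) (use f in simp)
  also have "\<dots> = (\<integral>\<xi>. \<sigma> ^ DIM('a) *\<^sub>R (cis (w \<bullet> \<xi>) * of_real (m \<xi> * gauss_symbol k (\<sigma> *\<^sub>R \<xi>))) \<partial>lborel)"
  proof (intro Bochner_Integration.integral_cong refl)
    fix \<xi> :: 'a
    have shift: "cis ((w - v) \<bullet> \<xi>) = cis (w \<bullet> \<xi>) * cis (v \<bullet> (- \<xi>))" for v
      by (simp add: cis_mult inner_diff_left)
    have "(\<integral>v. ?f (v, \<xi>) \<partial>lborel)
      = (\<integral>v. (cis (w \<bullet> \<xi>) * of_real (m \<xi>)) * (?G v *\<^sub>R cis (v \<bullet> (- \<xi>))) \<partial>lborel)"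
      by (intro Bochner_Integration.integral_cong refl)
        (simp add: scaleR_conv_of_real shift)
    also have "\<dots> = (cis (w \<bullet> \<xi>) * of_real (m \<xi>)) * (\<integral>v. ?G v *\<^sub>R cis (v \<bullet> (- \<xi>)) \<partial>lborel)"
      by (rule integral_mult_right_zero)
    also have "(\<integral>v. ?G v *\<^sub>R cis (v \<bullet> (- \<xi>)) \<partial>lborel)
        = \<sigma> ^ DIM('a) *\<^sub>R (\<integral>u. gauss_kernel k u *\<^sub>R cis (u \<bullet> (- (\<sigma> *\<^sub>R \<xi>))) \<partial>lborel)"
      using l by (subst integral_lborel_affine[where c = \<sigma> and t = 0]) auto
    also have "\<dots> = \<sigma> ^ DIM('a) *\<^sub>R of_real (gauss_symbol k (\<sigma> *\<^sub>R \<xi>))"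
      unfolding gauss_kernel_fourier(2) by (simp add: gauss_symbol_def)
    finally show "(\<integral>v. ?f (v, \<xi>) \<partial>lborel)
        = \<sigma> ^ DIM('a) *\<^sub>R (cis (w \<bullet> \<xi>) * of_real (m \<xi> * gauss_symbol k (\<sigma> *\<^sub>R \<xi>)))"
      by (simp add: scaleR_conv_of_real)
  qed
  also have "\<dots> = \<sigma> ^ DIM('a) *\<^sub>R oscint (\<lambda>\<xi>. m \<xi> * gauss_symbol k (\<sigma> *\<^sub>R \<xi>)) w"
    unfolding oscint_def by (rule integral_scaleR_right)
  finally have "(\<integral>v. ?G v *\<^sub>R oscint m (w - v) \<partial>lborel)
      = \<sigma> ^ DIM('a) *\<^sub>R oscint (\<lambda>\<xi>. m \<xi> * gauss_symbol k (\<sigma> *\<^sub>R \<xi>)) w" .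
  moreover have "(\<integral>v. ?G v *\<^sub>R inv_fourier m (w - v) \<partial>lborel)
     = (1 / (2 * pi) ^ DIM('a)) *\<^sub>R (\<integral>v. ?G v *\<^sub>R oscint m (w - v) \<partial>lborel)"
    unfolding inv_fourier_eq_oscint
    by (subst integral_scaleR_right[symmetric]) (simp add: mult.commute)
  ultimately show ?thesis using l by (simp add: inv_fourier_eq_oscint)
qed

lemma inv_fourier_dilate:
  fixes m :: "'a::euclidean_space \<Rightarrow> real"
  assumes [measurable]: "m \<in> borel_measurable borel" and t: "0 < t"
  shows "inv_fourier (\<lambda>\<xi>. m ((1 / t) *\<^sub>R \<xi>)) x = t ^ DIM('a) *\<^sub>R inv_fourier m (t *\<^sub>R x)"
  unfolding inv_fourier_def
  using t by (subst integral_lborel_affine[where c = t and t = 0]) (auto simp: mult.commute)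

text \<open>
  The substitution \<open>v = t (y - z)\<close> turns the convolution over \<open>v\<close> that represents the kernel of the
  block at \<open>x - z\<close> into an integral over \<open>y\<close>, in which \<open>z\<close> occurs only in the Gaussian kernel.
\<close>

lemma dyadic_block_eq_convolution:
  fixes m \<psi> :: "'a::euclidean_space \<Rightarrow> real"
  assumes fin: "finite_measure \<mu>" and sets[measurable_cong]: "sets \<mu> = sets borel"
    and int: "integrable lborel m" and L: "integrable lborel (inv_fourier m)"
    and \<psi>: "\<And>\<xi>. \<psi> \<xi> = m \<xi> * gauss_symbol k (\<sigma> *\<^sub>R \<xi>)" and [measurable]: "\<psi> \<in> borel_measurable borel"
    and l: "0 < \<sigma>" and t: "0 < t"
  shows "(\<integral>z. inv_fourier (\<lambda>\<xi>. \<psi> ((1 / t) *\<^sub>R \<xi>)) (x - z) \<partial>\<mu>)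
    = (t ^ DIM('a) * (t / \<sigma>) ^ DIM('a)) *\<^sub>R (\<integral>y. inv_fourier m (t *\<^sub>R (x - y)) *
          of_real (\<integral>z. gauss_kernel k ((1 / (\<sigma> / t)) *\<^sub>R (y - z)) \<partial>\<mu>) \<partial>lborel)"
proof -
  interpret \<mu>: finite_measure \<mu> by (rule fin)
  interpret P: pair_sigma_finite lborel \<mu> by standard
  let ?L = "inv_fourier m"
  have [measurable]: "m \<in> borel_measurable borel" using int by auto
  have mL[measurable]: "?L \<in> borel_measurable borel" by measurable
  let ?K = "\<lambda>y z. gauss_kernel k ((t / \<sigma>) *\<^sub>R (y - z))"
  let ?f = "\<lambda>(y, z). ?L (t *\<^sub>R (x - y)) * of_real (?K y z)"
  obtain C where C: "\<And>z :: 'a. \<bar>gauss_kernel k z\<bar> \<le> C" using gauss_kernel_bounded by blast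
  have "integrable lborel (\<lambda>y. ?L (t *\<^sub>R x + (- t) *\<^sub>R y))"
    by (rule integrable_lborel_affine) (use L t in auto)
  then have L': "integrable lborel (\<lambda>y. norm (?L (t *\<^sub>R (x - y))))"
    by (intro integrable_norm) (simp add: scaleR_diff_right)
  have f: "integrable (lborel \<Otimes>\<^sub>M \<mu>) ?f"
  proof (rule P.integrable_product_bound[OF _ L'])
    show "integrable \<mu> (\<lambda>_. C)" by simp
    show "norm (?f (y, z)) \<le> \<bar>norm (?L (t *\<^sub>R (x - y)))\<bar> * \<bar>C\<bar>" for y z
      using C[of "(t / \<sigma>) *\<^sub>R (y - z)"] by (auto simp: norm_mult intro!: mult_left_mono)
  qed measurable
  have "inv_fourier (\<lambda>\<xi>. \<psi> ((1 / t) *\<^sub>R \<xi>)) (x - z)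
     = (t ^ DIM('a) * (t / \<sigma>) ^ DIM('a)) *\<^sub>R (\<integral>y. ?f (y, z) \<partial>lborel)" for z
  proof -
    have "inv_fourier (\<lambda>\<xi>. \<psi> ((1 / t) *\<^sub>R \<xi>)) (x - z) = t ^ DIM('a) *\<^sub>R inv_fourier \<psi> (t *\<^sub>R (x - z))"
      by (rule inv_fourier_dilate[OF _ t]) measurable
    also have "inv_fourier \<psi> (t *\<^sub>R (x - z)) =
        (1 / \<sigma> ^ DIM('a)) *\<^sub>R (\<integral>v. gauss_kernel k ((1 / \<sigma>) *\<^sub>R v) *\<^sub>R ?L (t *\<^sub>R (x - z) - v) \<partial>lborel)"
      using inv_fourier_mult_gauss_symbol[OF int l, where k = k] unfolding \<psi>[symmetric] .
    also have "(\<integral>v. gauss_kernel k ((1 / \<sigma>) *\<^sub>R v) *\<^sub>R ?L (t *\<^sub>R (x - z) - v) \<partial>lborel)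
       = t ^ DIM('a) *\<^sub>R (\<integral>y. ?f (y, z) \<partial>lborel)"
      using t by (subst integral_lborel_affine[where c = t and t = "- t *\<^sub>R z"])
        (auto simp: scaleR_conv_of_real algebra_simps intro!: Bochner_Integration.integral_cong)
    finally show ?thesis using l by (simp add: power_divide)
  qed
  then have "(\<integral>z. inv_fourier (\<lambda>\<xi>. \<psi> ((1 / t) *\<^sub>R \<xi>)) (x - z) \<partial>\<mu>)
    = (t ^ DIM('a) * (t / \<sigma>) ^ DIM('a)) *\<^sub>R (\<integral>z. (\<integral>y. ?f (y, z) \<partial>lborel) \<partial>\<mu>)"
    by (simp only: integral_scaleR_right)
  also have "(\<integral>z. (\<integral>y. ?f (y, z) \<partial>lborel) \<partial>\<mu>) = (\<integral>y. (\<integral>z. ?f (y, z) \<partial>\<mu>) \<partial>lborel)"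
    by (rule P.Fubini_integral) (use f in simp)
  finally show ?thesis by simp
qed

section \<open>The bound for the dyadic blocks\<close>

lemma norm_integral_le_nn_integral:
  fixes f :: "'b \<Rightarrow> 'c::{banach, second_countable_topology}"
  shows "ennreal (norm (\<integral>x. f x \<partial>M)) \<le> (\<integral>\<^sup>+x. ennreal (norm (f x)) \<partial>M)"
  using integral_norm_bound_ennreal[of M f]
  by (cases "integrable M f") (auto simp: not_integrable_integral_eq)

lemma dyadic_symbol_eq_dilate:
  fixes \<phi> :: "'a::euclidean_space \<Rightarrow> real"
  shows "dyadic_symbol \<phi> j = (\<lambda>\<xi>. (\<lambda>\<zeta>. \<phi> \<zeta> - \<phi> (2 *\<^sub>R \<zeta>)) ((1 / 2 powi j) *\<^sub>R \<xi>))"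
proof
  fix \<xi> :: 'a
  have "(2::real) powi (- j + 1) = 2 * (1 / 2 powi j)"
    by (subst power_int_add) (simp_all add: power_int_minus divide_inverse)
  then show "dyadic_symbol \<phi> j \<xi> = (\<lambda>\<zeta>. \<phi> \<zeta> - \<phi> (2 *\<^sub>R \<zeta>)) ((1 / 2 powi j) *\<^sub>R \<xi>)"
    by (simp add: dyadic_symbol_def power_int_minus divide_inverse)
qed

lemma multiplier_distr_of_measure:
  "multiplier m (distr_of_measure \<mu>) x = (\<integral>z. inv_fourier m (x - z) \<partial>\<mu>)"
  by (simp add: multiplier_def distr_of_measure_def)

lemma borel_measurable_multiplier:
  fixes \<mu> :: "'a::euclidean_space measure"
  assumes fin: "finite_measure \<mu>" and sets[measurable_cong]: "sets \<mu> = sets borel"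
    and [measurable]: "m \<in> borel_measurable borel"
  shows "multiplier m (distr_of_measure \<mu>) \<in> borel_measurable borel"
proof -
  interpret finite_measure \<mu> by (rule fin)
  have [measurable]: "inv_fourier m \<in> borel_measurable borel" by measurable
  show ?thesis unfolding multiplier_distr_of_measure[abs_def] by measurable
qed

lemma lp_cutoffD:
  assumes "lp_cutoff \<phi>"
  shows "smooth \<phi>" "norm \<xi> \<le> 1 \<Longrightarrow> \<phi> \<xi> = 1" "2 \<le> norm \<xi> \<Longrightarrow> \<phi> \<xi> = 0"
  using assms unfolding lp_cutoff_def by blast+

text \<open>
  Near the zeros of \<open>gauss_symbol\<close> the quotient is smooth because its numerator vanishes there
  identically: the open sets \<open>\<bar>\<xi>\<bar> < 1/2\<close>, where the quotient is zero, and \<open>\<bar>\<xi>\<bar> > 1/4\<close>, where the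
  denominator is not zero, cover the space.
\<close>

lemma dyadic_block_factorization:
  fixes \<phi> :: "'a::euclidean_space \<Rightarrow> real"
  assumes "lp_cutoff \<phi>"
  shows "\<exists>\<sigma>>0. \<exists>m. (\<forall>n. Cn_on n UNIV m) \<and> (\<forall>\<xi>. 2 < norm \<xi> \<longrightarrow> m \<xi> = 0) \<and>
    (\<forall>\<xi>. \<phi> \<xi> - \<phi> (2 *\<^sub>R \<xi>) = m \<xi> * gauss_symbol k (\<sigma> *\<^sub>R \<xi>))"
proof -
  have \<phi>: "smooth \<phi>" "\<And>\<xi>. norm \<xi> \<le> 1 \<Longrightarrow> \<phi> \<xi> = 1" "\<And>\<xi>. 2 \<le> norm \<xi> \<Longrightarrow> \<phi> \<xi> = 0"
    using lp_cutoffD[OF assms] by blast+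
  obtain \<sigma> where l: "0 < \<sigma>" and nz: "\<And>\<xi>::'a. 1 / 4 < norm \<xi> \<Longrightarrow> gauss_symbol k (\<sigma> *\<^sub>R \<xi>) \<noteq> 0"
    using gauss_symbol_nonzero[where 'a = 'a and k = k] by auto
  define \<psi> where "\<psi> = (\<lambda>\<xi>. \<phi> \<xi> - \<phi> (2 *\<^sub>R \<xi>))"
  define m where "m = (\<lambda>\<xi>. \<psi> \<xi> * inverse (gauss_symbol k (\<sigma> *\<^sub>R \<xi>)))"
  have \<psi>: "Cn_on n UNIV \<psi>" for n
    unfolding \<psi>_def by (intro Cn_on_diff Cn_on_scale smooth_imp_Cn_on \<phi> open_UNIV)
  have \<psi>0: "\<psi> \<xi> = 0" if "norm \<xi> \<le> 1 / 2" for \<xi>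
    using that by (simp add: \<psi>_def \<phi>)
  let ?U = "{\<xi>::'a. norm \<xi> < 1 / 2}" and ?V = "{\<xi>::'a. 1 / 4 < norm \<xi>}"
  have op: "open ?U" "open ?V" by (intro open_Collect_less continuous_intros)+
  have "Cn_on n (?U \<union> ?V) m" for n
  proof (rule Cn_on_Un[OF op])
    show "Cn_on n ?U m"
      by (rule Cn_on_cong[OF op(1) Cn_on_const[of _ _ 0]]) (simp add: m_def \<psi>0)
    show "Cn_on n ?V m" unfolding m_def
      by (intro Cn_on_mult Cn_on_inverse op Cn_on_subset[OF \<psi>] Cn_on_subset[OF Cn_on_gauss_symbol])
        (auto simp: nz)
  qed
  moreover have "?U \<union> ?V = UNIV" by auto
  ultimately have "Cn_on n UNIV m" for n by metis
  moreover have "m \<xi> = 0" if "2 < norm \<xi>" for \<xi>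
    using that by (simp add: m_def \<psi>_def \<phi>)
  moreover have "\<psi> \<xi> = m \<xi> * gauss_symbol k (\<sigma> *\<^sub>R \<xi>)" for \<xi>
    using nz[of \<xi>] \<psi>0[of \<xi>] by (cases "1 / 4 < norm \<xi>") (auto simp: m_def)
  ultimately show ?thesis using l unfolding \<psi>_def by blast
qed

lemma nn_integral_decay_bound:
  fixes f :: "'a::euclidean_space \<Rightarrow> 'b::real_normed_vector"
  assumes "0 \<le> C" "\<And>x. norm (f x) \<le> C * decay_weight x"
  shows "(\<integral>\<^sup>+x. ennreal (norm (f x)) \<partial>lborel) \<le> ennreal (C * pi ^ DIM('a))"
proof -
  have "(\<integral>\<^sup>+x. ennreal (norm (f x)) \<partial>lborel) \<le> (\<integral>\<^sup>+x. ennreal C * ennreal (decay_weight x) \<partial>(lborel :: 'a measure))"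
    unfolding ennreal_mult'[OF assms(1), symmetric]
    by (intro nn_integral_mono ennreal_leI assms(2))
  also have "\<dots> = ennreal (C * pi ^ DIM('a))"
    using assms(1) by (simp add: nn_integral_cmult decay_weight_integrable ennreal_mult)
  finally show ?thesis .
qed

text \<open>
  The powers of \<open>s = \<sigma>/2\<^sup>j\<close> combine: \<open>s\<^sup>\<alpha>\<^sup>+\<^sup>d\<close> comes from the averages, \<open>s\<^sup>-\<^sup>d\<close> from the
  normalisation of the kernel, and the remaining \<open>s\<^sup>\<alpha>\<close> is \<open>\<sigma>\<^sup>\<alpha>\<close> divided by the weight
  \<open>2\<^sup>j\<^sup>\<alpha>\<close>.
\<close>

lemma dyadic_block_bound:
  fixes \<phi> :: "'a::euclidean_space \<Rightarrow> real"
  assumes \<alpha>: "0 < \<alpha>" and p: "1 \<le> p" "p \<noteq> \<infinity>" and q: "1 \<le> q" and \<phi>: "lp_cutoff \<phi>"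
  shows "\<exists>C>0. \<forall>(\<mu> :: 'a measure) j. finite_measure \<mu> \<longrightarrow> sets \<mu> = sets borel \<longrightarrow>
    ennreal (2 powr (real_of_int j * \<alpha>)) *
      Lp_norm lborel q (\<lambda>x. ennreal (norm (multiplier (dyadic_symbol \<phi> j) (distr_of_measure \<mu>) x)))
    \<le> ennreal C * sbe_norm \<alpha> p q \<mu>"
proof -
  define k where "k = nat \<lceil>\<alpha> + real DIM('a) - 1\<rceil>"
  define \<psi> where "\<psi> = (\<lambda>\<xi>. \<phi> \<xi> - \<phi> (2 *\<^sub>R \<xi>))"
  obtain C1 where C1: "0 < C1" "\<And>(\<mu> :: 'a measure) s y. finite_measure \<mu> \<Longrightarrow> sets \<mu> = sets borel \<Longrightarrow> 0 < s \<Longrightarrow>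
     ennreal \<bar>\<integral>x. gauss_kernel k ((1 / s) *\<^sub>R (y - x)) \<partial>\<mu>\<bar>
       \<le> ennreal (C1 * s powr (\<alpha> + real DIM('a))) * sbe_profile \<alpha> p k \<mu> y"
    using gauss_kernel_average_le_profile[OF p \<alpha>] by blast
  obtain \<sigma> m where l: "0 < \<sigma>" and m: "\<And>n. Cn_on n UNIV m" "\<And>\<xi>. 2 < norm \<xi> \<Longrightarrow> m \<xi> = 0"
    and \<psi>m: "\<And>\<xi>. \<psi> \<xi> = m \<xi> * gauss_symbol k (\<sigma> *\<^sub>R \<xi>)"
    using dyadic_block_factorization[OF \<phi>] unfolding \<psi>_def by blast
  let ?L = "inv_fourier m"
  have cm: "continuous_on UNIV m" using m(1)[of 0] by simp
  have im: "integrable lborel m" by (rule integrable_compact_support[OF cm m(2)])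
  have [measurable]: "m \<in> borel_measurable borel" using im by auto
  have [measurable]: "?L \<in> borel_measurable borel" by measurable
  have "continuous_on UNIV \<phi>"
    using smooth_imp_Cn_on[OF lp_cutoffD(1)[OF \<phi>], of 0] by simp
  then have [measurable]: "\<phi> \<in> borel_measurable borel" by (rule borel_measurable_continuous_onI)
  have [measurable]: "\<psi> \<in> borel_measurable borel" unfolding \<psi>_def by measurable
  obtain C2 where C2: "0 < C2" "\<And>x. norm (?L x) \<le> C2 * decay_weight x"
    using inv_fourier_decay[OF m] by blast
  have intL: "(\<integral>\<^sup>+x. ennreal (norm (?L x)) \<partial>lborel) \<le> ennreal (C2 * pi ^ DIM('a))"
    by (rule nn_integral_decay_bound) (use C2 in auto)
  have L: "integrable lborel ?L"
    unfolding integrable_iff_bounded using intL by (auto intro: le_less_trans)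
  define C where "C = C1 * \<sigma> powr \<alpha> * C2 * pi ^ DIM('a)"
  have "0 < C" using C1 C2 l by (simp add: C_def)
  moreover have "ennreal (2 powr (real_of_int j * \<alpha>)) *
      Lp_norm lborel q (\<lambda>x. ennreal (norm (multiplier (dyadic_symbol \<phi> j) (distr_of_measure \<mu>) x)))
    \<le> ennreal C * sbe_norm \<alpha> p q \<mu>"
    if fin: "finite_measure \<mu>" and sets: "sets \<mu> = sets borel" for \<mu> :: "'a measure" and j
  proof -
    define t :: real where "t = 2 powi j"
    have t: "0 < t" by (simp add: t_def)
    define s where "s = \<sigma> / t"
    have s: "0 < s" using l t by (simp add: s_def)
    define c where "c = C1 * s powr \<alpha>"
    have c: "0 < c" using C1 s by (simp add: c_def)
    let ?G = "sbe_profile \<alpha> p k \<mu>"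
    have [measurable]: "?G \<in> borel_measurable borel"
      by (rule borel_measurable_sbe_profile[OF fin sets p(2)])
    define I where "I y = (\<integral>z. gauss_kernel k ((1 / s) *\<^sub>R (y - z)) \<partial>\<mu>)" for y
    have sym: "dyadic_symbol \<phi> j = (\<lambda>\<xi>. \<psi> ((1 / t) *\<^sub>R \<xi>))"
      unfolding dyadic_symbol_eq_dilate t_def \<psi>_def ..
    \<comment> \<open>The dilate of the kernel, with all the constants of the pointwise bound.\<close>
    define l0 where "l0 z = ennreal c * (ennreal (t ^ DIM('a)) * ennreal (norm (?L (t *\<^sub>R z))))" for z
    have [measurable]: "l0 \<in> borel_measurable borel" unfolding l0_def by measurable
    have int_l0: "(\<integral>\<^sup>+z. l0 z \<partial>lborel) \<le> ennreal (c * (C2 * pi ^ DIM('a)))"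
    proof -
      have "(\<integral>\<^sup>+z. l0 z \<partial>lborel) = ennreal c * (ennreal (t ^ DIM('a)) * (\<integral>\<^sup>+z. ennreal (norm (?L (t *\<^sub>R z))) \<partial>lborel))"
        unfolding l0_def by (simp add: nn_integral_cmult)
      also have "ennreal (t ^ DIM('a)) * (\<integral>\<^sup>+z. ennreal (norm (?L (t *\<^sub>R z))) \<partial>lborel) = (\<integral>\<^sup>+z. ennreal (norm (?L z)) \<partial>lborel)"
        using nn_integral_lborel_affine[of "\<lambda>z. ennreal (norm (?L z))" t 0] t by (simp add: ennreal_power)
      also have "ennreal c * \<dots> \<le> ennreal c * ennreal (C2 * pi ^ DIM('a))"
        by (intro mult_left_mono intL) auto
      finally show ?thesis using c C2 by (simp add: ennreal_mult)
    qed
    have pt: "ennreal (norm (multiplier (dyadic_symbol \<phi> j) (distr_of_measure \<mu>) x))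
      \<le> (\<integral>\<^sup>+y. l0 (x - y) * ?G y \<partial>lborel)" for x
    proof -
      define e where "e = t ^ DIM('a) * (t / \<sigma>) ^ DIM('a)"
      have e: "0 \<le> e" using t l by (simp add: e_def)
      have "multiplier (dyadic_symbol \<phi> j) (distr_of_measure \<mu>) x = e *\<^sub>R (\<integral>y. ?L (t *\<^sub>R (x - y)) * of_real (I y) \<partial>lborel)"
        unfolding multiplier_distr_of_measure sym I_def s_def e_def
        by (rule dyadic_block_eq_convolution[OF fin sets im L \<psi>m _ l t]) measurable
      also have "\<dots> = (\<integral>y. e *\<^sub>R (?L (t *\<^sub>R (x - y)) * of_real (I y)) \<partial>lborel)"
        by (rule integral_scaleR_right[symmetric])
      finally have "ennreal (norm (multiplier (dyadic_symbol \<phi> j) (distr_of_measure \<mu>) x))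
        \<le> (\<integral>\<^sup>+y. ennreal (norm (e *\<^sub>R (?L (t *\<^sub>R (x - y)) * of_real (I y)))) \<partial>lborel)"
        using norm_integral_le_nn_integral by metis
      also have "\<dots> \<le> (\<integral>\<^sup>+y. l0 (x - y) * ?G y \<partial>lborel)"
      proof (rule nn_integral_mono)
        fix y
        let ?N = "norm (?L (t *\<^sub>R (x - y)))"
        have "ennreal (norm (e *\<^sub>R (?L (t *\<^sub>R (x - y)) * of_real (I y)))) = ennreal (e * ?N) * ennreal \<bar>I y\<bar>"
          using e by (simp add: norm_mult ennreal_mult mult.assoc)
        also have "\<dots> \<le> ennreal (e * ?N) * (ennreal (C1 * s powr (\<alpha> + real DIM('a))) * ?G y)"
          unfolding I_def by (intro mult_left_mono C1 fin sets s) auto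
        also have "\<dots> = ennreal (e * ?N * (C1 * s powr (\<alpha> + real DIM('a)))) * ?G y"
          using e C1 s by (simp add: ennreal_mult mult.assoc)
        also have "e * ?N * (C1 * s powr (\<alpha> + real DIM('a))) = c * (t ^ DIM('a) * ?N)"
        proof -
          have "(t / \<sigma>) ^ DIM('a) * s powr real DIM('a) = 1"
            using s t l by (simp add: powr_realpow power_mult_distrib[symmetric] s_def)
          then show ?thesis by (simp add: e_def c_def powr_add algebra_simps)
        qed
        also have "ennreal (c * (t ^ DIM('a) * ?N)) = l0 (x - y)"
          unfolding l0_def using c t by (simp add: ennreal_mult)
        finally show "ennreal (norm (e *\<^sub>R (?L (t *\<^sub>R (x - y)) * of_real (I y)))) \<le> l0 (x - y) * ?G y" .
      qed
      finally show ?thesis .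
    qed
    have mm: "multiplier (dyadic_symbol \<phi> j) (distr_of_measure \<mu>) \<in> borel_measurable borel"
      unfolding sym by (rule borel_measurable_multiplier[OF fin sets]) measurable
    have "Lp_norm lborel q (\<lambda>x. ennreal (norm (multiplier (dyadic_symbol \<phi> j) (distr_of_measure \<mu>) x)))
      \<le> Lp_norm lborel q (\<lambda>x. \<integral>\<^sup>+y. l0 (x - y) * ?G y \<partial>lborel)"
      by (intro Lp_norm_mono pt) (use mm in measurable)
    also have "\<dots> \<le> ennreal (c * (C2 * pi ^ DIM('a))) * Lp_norm lborel q ?G"
      by (rule Lp_norm_convolution_le[OF _ _ q _ int_l0]) (use c C2 in auto)
    finally have "ennreal (2 powr (real_of_int j * \<alpha>)) *
        Lp_norm lborel q (\<lambda>x. ennreal (norm (multiplier (dyadic_symbol \<phi> j) (distr_of_measure \<mu>) x)))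
      \<le> ennreal (2 powr (real_of_int j * \<alpha>)) * (ennreal (c * (C2 * pi ^ DIM('a))) * Lp_norm lborel q ?G)"
      by (rule mult_left_mono) auto
    also have "\<dots> = ennreal (2 powr (real_of_int j * \<alpha>) * (c * (C2 * pi ^ DIM('a)))) * Lp_norm lborel q ?G"
      using c C2 by (simp add: ennreal_mult mult.assoc)
    also have "2 powr (real_of_int j * \<alpha>) * (c * (C2 * pi ^ DIM('a))) = C"
    proof -
      have "t = 2 powr real_of_int j" by (simp add: t_def powr_real_of_int')
      then have "2 powr (real_of_int j * \<alpha>) * s powr \<alpha> = \<sigma> powr \<alpha>"
        using l by (simp add: s_def powr_powr[symmetric] powr_divide)
      then show ?thesis by (simp add: C_def c_def algebra_simps)
    qed
    finally show ?thesis by (simp add: sbe_norm_eq_profile k_def)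
  qed
  ultimately show ?thesis by blast
qed

section \<open>The low frequencies and the total mass\<close>

lemma emeasure_dr_over_r_interval:
  assumes "0 < a" "a < b"
  shows "ennreal ((b - a) / b) \<le> emeasure dr_over_r {a..<b}"
proof -
  have "ennreal ((b - a) / b) = (\<integral>\<^sup>+r. ennreal (1 / b) * indicator {a..<b} r \<partial>lborel)"
    using assms by (simp add: nn_integral_cmult_indicator ennreal_mult[symmetric])
  also have "\<dots> \<le> (\<integral>\<^sup>+r. (if 0 < r then ennreal (1 / r) else 0) * indicator {a..<b} r \<partial>lborel)"
    using assms by (intro nn_integral_mono) (auto simp: indicator_def intro!: ennreal_leI divide_left_mono)
  also have "\<dots> = emeasure dr_over_r {a..<b}"
    unfolding dr_over_r_def by (subst emeasure_density) auto
  finally show ?thesis .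
qed

text \<open>
  For centres \<open>y\<close> at distance between \<open>5R\<close> and \<open>6R\<close> from \<open>c\<close>, the support lies between the spheres
  of radius \<open>4R\<close> and \<open>7R\<close> around \<open>y\<close>. Radii \<open>r\<close> with \<open>r/2\<^sup>k\<^sup>+\<^sup>1\<close> slightly below \<open>4R\<close> then see no
  mass in the smallest ball and all of it in the others, and as the coefficients sum to zero only
  the last one survives.
\<close>

lemma total_mass_le_sbe_norm:
  assumes p: "1 \<le> p" and q: "1 \<le> q" and R: "0 < R"
  shows "\<exists>C>0. \<forall>(\<mu> :: 'a::euclidean_space measure) c. finite_measure \<mu> \<longrightarrow> sets \<mu> = sets borel \<longrightarrow>
    emeasure \<mu> (- cball c R) = 0 \<longrightarrow> ennreal (measure \<mu> UNIV) \<le> ennreal C * sbe_norm \<alpha> p q \<mu>"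
proof -
  define k where "k = nat \<lceil>\<alpha> + real DIM('a) - 1\<rceil>"
  obtain b :: 'a where b: "b \<in> Basis" using nonempty_Basis by blast
  define A where "A = 2 ^ (k + 1) * (7 / 2 * R)"
  define B where "B = 2 ^ (k + 1) * (4 * R)"
  have AB: "0 < A" "A < B" using R by (simp_all add: A_def B_def)
  define a where "a = dyadic_coeff k (k + 1)"
  have a: "a \<noteq> 0" unfolding a_def by (rule dyadic_coeff_top_nonzero)
  \<comment> \<open>A lower bound for \<open>r\<^sup>-\<^sup>\<alpha>\<^sup>-\<^sup>d\<close> on the interval, whatever the sign of the exponent.\<close>
  define w where "w = min (A powr (- \<alpha> - real DIM('a))) (B powr (- \<alpha> - real DIM('a)))"
  have w: "0 < w" using AB by (simp add: w_def)
  define \<eta>1 where "\<eta>1 = (B - A) / B"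
  have \<eta>1: "0 < \<eta>1" "ennreal \<eta>1 \<le> emeasure dr_over_r {A..<B}"
    using AB emeasure_dr_over_r_interval[OF AB] by (simp_all add: \<eta>1_def)
  define Y where "Y c = cball (c + (11 / 2 * R) *\<^sub>R b) (R / 2)" for c
  define \<eta>2 where "\<eta>2 = measure lborel (cball (0::'a) (R / 2))"
  have \<eta>2: "0 < \<eta>2" "ennreal \<eta>2 \<le> emeasure lborel (Y c)" for c
  proof -
    show "0 < \<eta>2" unfolding \<eta>2_def using R by (simp add: content_cball)
    have "emeasure lborel (Y c) = ennreal (measure lborel (Y c))"
      using emeasure_lborel_cball_finite[of "c + (11 / 2 * R) *\<^sub>R b" "R / 2"]
      by (intro emeasure_eq_ennreal_measure) (auto simp: Y_def)
    also have "measure lborel (Y c) = \<eta>2" unfolding Y_def \<eta>2_def using R by (simp add: content_cball)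
    finally show "ennreal \<eta>2 \<le> emeasure lborel (Y c)" by simp
  qed
  define \<kappa> where "\<kappa> = w * \<bar>a\<bar> * (\<eta>1 powr (1 / enn2real p)) * (\<eta>2 powr (1 / enn2real q))"
  have \<kappa>: "0 < \<kappa>" using w a \<eta>1 \<eta>2 by (simp add: \<kappa>_def)
  have "ennreal (measure \<mu> UNIV) \<le> ennreal (1 / \<kappa>) * sbe_norm \<alpha> p q \<mu>"
    if fin: "finite_measure \<mu>" and sets: "sets \<mu> = sets borel" and supp: "emeasure \<mu> (- cball c R) = 0"
    for \<mu> :: "'a measure" and c
  proof -
    interpret finite_measure \<mu> by (rule fin)
    define M where "M = measure \<mu> UNIV"
    have space: "space \<mu> = UNIV" using sets_eq_imp_space_eq[OF sets] by simp
    have null: "measure \<mu> S = 0" if "S \<in> sets borel" "S \<inter> cball c R = {}" for S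
    proof -
      have "emeasure \<mu> S \<le> emeasure \<mu> (- cball c R)"
        using that by (intro emeasure_mono) (auto simp: sets)
      then show ?thesis using supp by (simp add: measure_def)
    qed
    have cb: "{x. norm (x - y) \<le> r} \<in> sets borel" for r and y :: 'a by measurable
    have full: "ball_mass \<mu> r y = M" if "\<And>x. x \<in> cball c R \<Longrightarrow> norm (x - y) \<le> r" for r y
    proof -
      have "measure \<mu> (- {x. norm (x - y) \<le> r}) = 0"
        using that cb by (intro null) auto
      then show ?thesis
        using finite_measure_compl[of "{x. norm (x - y) \<le> r}"] cb
        by (simp add: sets space Compl_eq_Diff_UNIV ball_mass_def M_def)
    qed
    have empty: "ball_mass \<mu> r y = 0" if "\<And>x. x \<in> cball c R \<Longrightarrow> r < norm (x - y)" for r y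
      unfolding ball_mass_def using that by (intro null cb) fastforce
    have diff: "dyadic_diff k (\<lambda>s. ball_mass \<mu> s y) r = - a * M" if y: "y \<in> Y c" and r: "r \<in> {A..<B}" for y r
    proof -
      define h where "h = (11 / 2 * R) *\<^sub>R b"
      define z where "z = y - (c + h)"
      have "norm z \<le> R / 2"
        using y by (simp add: z_def h_def Y_def dist_norm norm_minus_commute)
      moreover have "norm h = 11 / 2 * R" using b R by (simp add: h_def)
      moreover have "y - c = h + z" by (simp add: z_def)
      ultimately have yc: "5 * R \<le> norm (y - c)" "norm (y - c) \<le> 6 * R"
        using norm_triangle_ineq[of h z] norm_diff_ineq[of h z] by simp_all
      have x: "4 * R \<le> norm (x - y)" "norm (x - y) \<le> 7 * R" if "x \<in> cball c R" for x
      proof -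
        have "norm (x - c) \<le> R" using that by (simp add: dist_norm norm_minus_commute)
        then show "4 * R \<le> norm (x - y)" "norm (x - y) \<le> 7 * R"
          using norm_triangle_ineq4[of "x - c" "y - c"] norm_triangle_ineq2[of "y - c" "x - c"] yc
          by (simp_all add: norm_minus_commute)
      qed
      have "ball_mass \<mu> (r / 2 ^ m) y = M" if "m \<le> k" for m
      proof (rule full)
        have "(2::real) ^ m \<le> 2 ^ k" using that by simp
        then have "7 * R * 2 ^ m \<le> 7 * R * 2 ^ k" using R by (intro mult_left_mono) auto
        also have "\<dots> \<le> r" using r by (simp add: A_def)
        finally have "7 * R \<le> r / 2 ^ m" by (simp add: pos_le_divide_eq)
        then show "norm (x - y) \<le> r / 2 ^ m" if "x \<in> cball c R" for x
          using x(2)[OF that] by simp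
      qed
      moreover have "ball_mass \<mu> (r / 2 ^ (k + 1)) y = 0"
      proof (rule empty)
        have "r / 2 ^ (k + 1) < 4 * R" using r by (simp add: B_def pos_divide_less_eq mult.commute)
        then show "r / 2 ^ (k + 1) < norm (x - y)" if "x \<in> cball c R" for x
          using x(1)[OF that] by linarith
      qed
      ultimately have "dyadic_diff k (\<lambda>s. ball_mass \<mu> s y) r = (\<Sum>m\<le>k. dyadic_coeff k m) * M"
        unfolding dyadic_diff_eq_sum by (simp add: sum_distrib_right)
      also have "(\<Sum>m\<le>k. dyadic_coeff k m) = - a"
        using sum_dyadic_coeff[of k] by (simp add: a_def)
      finally show ?thesis .
    qed
    have prof: "ennreal (w * \<bar>a\<bar> * M) * ennreal (\<eta>1 powr (1 / enn2real p)) \<le> sbe_profile \<alpha> p k \<mu> y" if y: "y \<in> Y c" for y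
      unfolding sbe_profile_def
    proof (rule Lp_norm_ge_on_set[OF _ \<eta>1 p])
      fix r assume r: "r \<in> {A..<B}"
      have "w \<le> r powr (- \<alpha> - real DIM('a))"
      proof (cases "0 \<le> - \<alpha> - real DIM('a)")
        case True
        then have "A powr (- \<alpha> - real DIM('a)) \<le> r powr (- \<alpha> - real DIM('a))"
          using r AB by (intro powr_mono2) auto
        then show ?thesis by (simp add: w_def)
      next
        case False
        then have "B powr (- \<alpha> - real DIM('a)) \<le> r powr (- \<alpha> - real DIM('a))"
          using r AB by (intro powr_mono2') auto
        then show ?thesis by (simp add: w_def)
      qed
      then have "w * (\<bar>a\<bar> * M) \<le> r powr (- \<alpha> - real DIM('a)) * (\<bar>a\<bar> * M)"
        by (intro mult_right_mono) (auto simp: M_def)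
      then show "ennreal (w * \<bar>a\<bar> * M) \<le> ennreal \<bar>r powr (- \<alpha> - real DIM('a)) * dyadic_diff k (\<lambda>s. ball_mass \<mu> s y) r\<bar>"
        unfolding diff[OF y r] by (intro ennreal_leI) (simp add: abs_mult mult.assoc M_def)
    qed simp
    have "ennreal (w * \<bar>a\<bar> * M) * ennreal (\<eta>1 powr (1 / enn2real p)) * ennreal (\<eta>2 powr (1 / enn2real q))
        \<le> Lp_norm lborel q (sbe_profile \<alpha> p k \<mu>)"
      by (rule Lp_norm_ge_on_set[OF _ \<eta>2(1) \<eta>2(2)[of c] q prof]) (auto simp: Y_def)
    also have "\<dots> = sbe_norm \<alpha> p q \<mu>" by (simp add: sbe_norm_eq_profile k_def)
    finally have "ennreal (\<kappa> * M) \<le> sbe_norm \<alpha> p q \<mu>"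
      using w by (simp add: \<kappa>_def ennreal_mult[symmetric] M_def mult_ac)
    then have "ennreal (1 / \<kappa>) * ennreal (\<kappa> * M) \<le> ennreal (1 / \<kappa>) * sbe_norm \<alpha> p q \<mu>"
      by (rule mult_left_mono) simp
    moreover have "ennreal (1 / \<kappa>) * ennreal (\<kappa> * M) = ennreal M"
      using \<kappa> by (simp add: ennreal_mult[symmetric] M_def)
    ultimately show ?thesis by (simp add: M_def)
  qed
  then show ?thesis using \<kappa> by (intro exI[of _ "1 / \<kappa>"]) auto
qed

lemma decay_weight_translate_le:
  fixes x w :: "'a::euclidean_space"
  assumes R: "norm w \<le> R"
  shows "decay_weight (x - w) \<le> (2 * (1 + R\<^sup>2)) ^ DIM('a) * decay_weight x"
proof -
  have "decay_weight (x - w) \<le> (\<Prod>b\<in>(Basis::'a set). 2 * (1 + R\<^sup>2) * inverse (1 + (x \<bullet> b)\<^sup>2))"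
    unfolding decay_weight_def
  proof (intro prod_mono conjI)
    fix b :: 'a assume b: "b \<in> Basis"
    define u where "u = (x - w) \<bullet> b"
    define v where "v = w \<bullet> b"
    have xb: "x \<bullet> b = u + v" by (simp add: u_def v_def inner_diff_left)
    have "\<bar>v\<bar> \<le> R" using Basis_le_norm[OF b, of w] R by (simp add: v_def)
    then have v: "v\<^sup>2 \<le> R\<^sup>2" using abs_le_square_iff by fastforce
    have "(u + v)\<^sup>2 \<le> 2 * u\<^sup>2 + 2 * v\<^sup>2"
      using sum_squares_bound[of u v] by (simp add: power2_sum)
    also have "\<dots> \<le> 2 * u\<^sup>2 + 2 * R\<^sup>2" using v by simp
    finally have "(u + v)\<^sup>2 \<le> 2 * u\<^sup>2 + 2 * R\<^sup>2" .
    moreover have "2 * (1 + R\<^sup>2) * (1 + u\<^sup>2) = 2 + 2 * u\<^sup>2 + 2 * R\<^sup>2 + 2 * (R\<^sup>2 * u\<^sup>2)"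
      by (simp add: algebra_simps)
    moreover have "0 \<le> R\<^sup>2 * u\<^sup>2" by simp
    ultimately have "1 + (u + v)\<^sup>2 \<le> 2 * (1 + R\<^sup>2) * (1 + u\<^sup>2)" by linarith
    moreover have "0 < 1 + u\<^sup>2" "0 < 1 + (u + v)\<^sup>2" by (simp_all add: add_pos_nonneg)
    ultimately show "inverse (1 + ((x - w) \<bullet> b)\<^sup>2) \<le> 2 * (1 + R\<^sup>2) * inverse (1 + (x \<bullet> b)\<^sup>2)"
      unfolding xb u_def[symmetric] by (simp add: field_simps)
  qed simp
  also have "\<dots> = (2 * (1 + R\<^sup>2)) ^ DIM('a) * decay_weight x"
    by (simp add: prod.distrib decay_weight_def)
  finally show ?thesis .
qed

text \<open>
  The kernel decays, and up to a factor depending on \<open>R\<close> the decay is the same from every point of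
  the support as from \<open>c\<close>; so the block is below the total mass times a function in every
  Lebesgue space.
\<close>

lemma low_frequency_bound:
  fixes \<phi> :: "'a::euclidean_space \<Rightarrow> real"
  assumes q: "1 \<le> q" and \<phi>: "lp_cutoff \<phi>" and R: "0 < R"
  shows "\<exists>C>0. \<forall>(\<mu> :: 'a measure) c. finite_measure \<mu> \<longrightarrow> sets \<mu> = sets borel \<longrightarrow>
    emeasure \<mu> (- cball c R) = 0 \<longrightarrow>
    Lp_norm lborel q (\<lambda>x. ennreal (norm (multiplier \<phi> (distr_of_measure \<mu>) x)))
      \<le> ennreal C * ennreal (measure \<mu> UNIV)"
proof -
  have C: "Cn_on n UNIV \<phi>" for n by (rule smooth_imp_Cn_on[OF lp_cutoffD(1)[OF \<phi>]])
  have s: "\<phi> \<xi> = 0" if "2 < norm \<xi>" for \<xi> using lp_cutoffD(3)[OF \<phi>, of \<xi>] that by simp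
  have [measurable]: "\<phi> \<in> borel_measurable borel"
    using C[of 0] by (auto intro: borel_measurable_continuous_onI)
  obtain C2 where C2: "0 < C2" "\<And>x. norm (inv_fourier \<phi> x) \<le> C2 * decay_weight x"
    using inv_fourier_decay[OF C s] by blast
  define D where "D = C2 * (2 * (1 + R\<^sup>2)) ^ DIM('a)"
  have D: "0 < D" using C2 by (simp add: D_def add_pos_nonneg)
  define \<kappa> where "\<kappa> = (pi ^ DIM('a)) powr (1 / enn2real q)"
  have \<kappa>: "0 < \<kappa>" by (simp add: \<kappa>_def)
  have "Lp_norm lborel q (\<lambda>x. ennreal (norm (multiplier \<phi> (distr_of_measure \<mu>) x)))
      \<le> ennreal (D * \<kappa>) * ennreal (measure \<mu> UNIV)"
    if fin: "finite_measure \<mu>" and sets[measurable_cong]: "sets \<mu> = sets borel" and supp: "emeasure \<mu> (- cball c R) = 0"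
    for \<mu> :: "'a measure" and c
  proof -
    interpret finite_measure \<mu> by (rule fin)
    have space: "space \<mu> = UNIV" using sets_eq_imp_space_eq[OF sets] by simp
    define M where "M = measure \<mu> UNIV"
    have AE: "AE z in \<mu>. z \<in> cball c R"
      using supp by (intro AE_I[of _ _ "- cball c R"]) (auto simp: sets)
    have pt: "ennreal (norm (multiplier \<phi> (distr_of_measure \<mu>) x)) \<le> ennreal (D * M) * ennreal (decay_weight (x - c))" for x
    proof -
      have "ennreal (norm (multiplier \<phi> (distr_of_measure \<mu>) x)) \<le> (\<integral>\<^sup>+z. ennreal (norm (inv_fourier \<phi> (x - z))) \<partial>\<mu>)"
        unfolding multiplier_distr_of_measure by (rule norm_integral_le_nn_integral)
      also have "\<dots> \<le> (\<integral>\<^sup>+z. ennreal (D * decay_weight (x - c)) \<partial>\<mu>)"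
      proof (intro nn_integral_mono_AE, use AE in eventually_elim)
        fix z assume "z \<in> cball c R"
        then have "norm (z - c) \<le> R" by (simp add: dist_norm norm_minus_commute)
        from decay_weight_translate_le[OF this, of "x - c"]
        have "decay_weight (x - z) \<le> (2 * (1 + R\<^sup>2)) ^ DIM('a) * decay_weight (x - c)" by simp
        then have "C2 * decay_weight (x - z) \<le> C2 * ((2 * (1 + R\<^sup>2)) ^ DIM('a) * decay_weight (x - c))"
          using C2 by (intro mult_left_mono) auto
        then show "ennreal (norm (inv_fourier \<phi> (x - z))) \<le> ennreal (D * decay_weight (x - c))"
          using C2(2)[of "x - z"] by (intro ennreal_leI) (simp add: D_def mult.assoc)
      qed
      also have "\<dots> = ennreal (D * M) * ennreal (decay_weight (x - c))"
        using D decay_weight_pos[of "x - c"]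
        by (simp add: emeasure_eq_measure space M_def ennreal_mult[symmetric] mult_ac)
      finally show ?thesis .
    qed
    have mm: "multiplier \<phi> (distr_of_measure \<mu>) \<in> borel_measurable borel"
      by (rule borel_measurable_multiplier[OF fin sets]) measurable
    have "Lp_norm lborel q (\<lambda>x. ennreal (norm (multiplier \<phi> (distr_of_measure \<mu>) x)))
       \<le> ennreal (D * M) * ennreal \<kappa>"
      unfolding \<kappa>_def
    proof (rule Lp_norm_le_of_bounded_integrable[OF _ _ q _ _ _ pt])
      have "(\<integral>\<^sup>+x. ennreal (decay_weight x) \<partial>(lborel :: 'a measure)) = (\<integral>\<^sup>+x. ennreal (decay_weight (x - c)) \<partial>lborel)"
        using nn_integral_lborel_affine[of "\<lambda>x. ennreal (decay_weight x)" 1 "- c"] by simp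
      then show "(\<integral>\<^sup>+x. ennreal (decay_weight (x - c)) \<partial>lborel) \<le> ennreal (pi ^ DIM('a))"
        using decay_weight_integrable[where 'a = 'a] by simp
      show "ennreal (decay_weight (x - c)) \<le> 1" for x
        using decay_weight_le_1 by simp
    qed (use mm in auto)
    then show ?thesis using D \<kappa> by (simp add: M_def ennreal_mult mult_ac)
  qed
  then show ?thesis using D \<kappa> by (intro exI[of _ "D * \<kappa>"]) auto
qed

section \<open>Measures as tempered distributions\<close>

lemma schwartz_imp_continuous_bounded:
  assumes "schwartz f"
  shows "continuous_on UNIV f" "bdd_above (range (\<lambda>x. norm (f x)))"
proof -
  have "\<forall>x. iter_deriv [] f differentiable (at x)" "bounded (range (\<lambda>x. (1 + norm x) ^ 0 *\<^sub>R iter_deriv [] f x))"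
    using assms unfolding schwartz_def smooth_def by (metis empty_subsetI list.set(1))+
  then show "continuous_on UNIV f" "bdd_above (range (\<lambda>x. norm (f x)))"
    by (auto intro!: continuous_at_imp_continuous_on differentiable_imp_continuous_within
        simp: bounded_iff bdd_above_def)
qed

text \<open>
  A finite measure is bounded by its total mass times the supremum norm, which is the seminorm of
  order zero.
\<close>

lemma tempered_distribution_distr_of_measure:
  fixes \<mu> :: "'a::euclidean_space measure"
  assumes fin: "finite_measure \<mu>" and sets: "sets \<mu> = sets borel"
  shows "tempered_distribution (distr_of_measure \<mu>)"
  unfolding tempered_distribution_def
proof (intro conjI allI impI exI)
  interpret finite_measure \<mu> by (rule fin)
  have space: "space \<mu> = UNIV" using sets_eq_imp_space_eq[OF sets] by simp
  have bd: "norm (f x) \<le> schwartz_seminorm 0 f" if "schwartz f" for f :: "'a \<Rightarrow> complex" and x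
  proof -
    have e: "{vs. set vs \<subseteq> Basis \<and> length vs \<le> 0} = {[] :: 'a list}" by auto
    have "schwartz_seminorm 0 f = (SUP x. norm (f x))"
      unfolding schwartz_seminorm_def e by simp
    then show ?thesis
      using cSUP_upper[OF _ schwartz_imp_continuous_bounded(2)[OF that], of x] by simp
  qed
  have int: "integrable \<mu> f" if "schwartz f" for f
  proof (rule integrable_const_bound)
    show "AE x in \<mu>. norm (f x) \<le> schwartz_seminorm 0 f" using bd[OF that] by simp
    show "f \<in> borel_measurable \<mu>"
      using borel_measurable_continuous_onI[OF schwartz_imp_continuous_bounded(1)[OF that]]
        measurable_cong_sets[OF sets refl] by blast
  qed
  show "distr_of_measure \<mu> (\<lambda>x. f x + g x) = distr_of_measure \<mu> f + distr_of_measure \<mu> g"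
    if "schwartz f" "schwartz g" for f g
    using int that by (simp add: distr_of_measure_def)
  show "distr_of_measure \<mu> (\<lambda>x. c * f x) = c * distr_of_measure \<mu> f" for c f
    by (simp add: distr_of_measure_def)
  show "norm (distr_of_measure \<mu> f) \<le> measure \<mu> UNIV * schwartz_seminorm 0 f" if "schwartz f" for f
  proof -
    have "norm (distr_of_measure \<mu> f) \<le> (\<integral>x. norm (f x) \<partial>\<mu>)"
      unfolding distr_of_measure_def by (rule integral_norm_bound)
    also have "\<dots> \<le> (\<integral>x. schwartz_seminorm 0 f \<partial>\<mu>)"
      by (intro integral_mono integrable_norm int that bd) auto
    finally show ?thesis by (simp add: space)
  qed
qed

section \<open>Besov norms of measures\<close>

lemma Lp_norm_count_space_infinity_le:
  "(\<And>j. f j \<le> c) \<Longrightarrow> Lp_norm (count_space UNIV) \<infinity> f \<le> c"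
  unfolding Lp_norm_def by (auto intro!: esssup_I)

text \<open>
  Only the block of index \<open>0\<close> makes the constant depend on \<open>R\<close>, through the total mass.
\<close>

lemma besov_norm_le_sbe_norm:
  fixes \<phi> :: "'a::euclidean_space \<Rightarrow> real"
  assumes \<alpha>: "0 < \<alpha>" and p: "1 \<le> p" "p \<noteq> \<infinity>" and q: "1 \<le> q" and \<phi>: "lp_cutoff \<phi>"
  shows "\<exists>C>0. \<forall>(\<mu> :: 'a measure) c. finite_measure \<mu> \<longrightarrow> sets \<mu> = sets borel \<longrightarrow>
    emeasure \<mu> (- cball c R) = 0 \<longrightarrow>
    besov_norm \<phi> \<alpha> q \<infinity> (distr_of_measure \<mu>) \<le> ennreal C * sbe_norm \<alpha> p q \<mu>"
proof -
  \<comment> \<open>The bounds through the total mass ask for a positive radius.\<close>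
  define R' where "R' = max R 1"
  have R': "0 < R'" by (simp add: R'_def)
  obtain C1 where C1: "0 < C1" "\<And>(\<mu> :: 'a measure) j. finite_measure \<mu> \<Longrightarrow> sets \<mu> = sets borel \<Longrightarrow>
    ennreal (2 powr (real_of_int j * \<alpha>)) *
      Lp_norm lborel q (\<lambda>x. ennreal (norm (multiplier (dyadic_symbol \<phi> j) (distr_of_measure \<mu>) x)))
    \<le> ennreal C1 * sbe_norm \<alpha> p q \<mu>"
    using dyadic_block_bound[OF \<alpha> p q \<phi>] by blast
  obtain C2 where C2: "0 < C2" "\<And>(\<mu> :: 'a measure) c. finite_measure \<mu> \<Longrightarrow> sets \<mu> = sets borel \<Longrightarrow>
    emeasure \<mu> (- cball c R') = 0 \<Longrightarrow> ennreal (measure \<mu> UNIV) \<le> ennreal C2 * sbe_norm \<alpha> p q \<mu>"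
    using total_mass_le_sbe_norm[OF p(1) q R'] by blast
  obtain C3 where C3: "0 < C3" "\<And>(\<mu> :: 'a measure) c. finite_measure \<mu> \<Longrightarrow> sets \<mu> = sets borel \<Longrightarrow>
    emeasure \<mu> (- cball c R') = 0 \<Longrightarrow>
    Lp_norm lborel q (\<lambda>x. ennreal (norm (multiplier \<phi> (distr_of_measure \<mu>) x)))
      \<le> ennreal C3 * ennreal (measure \<mu> UNIV)"
    using low_frequency_bound[OF q \<phi> R'] by blast
  define C where "C = max C1 (C3 * C2)"
  have C: "0 < C" "ennreal C1 \<le> ennreal C" "ennreal C3 * ennreal C2 \<le> ennreal C"
    using C1 C2 C3 by (auto simp: C_def ennreal_mult[symmetric] intro: ennreal_leI)
  have "besov_norm \<phi> \<alpha> q \<infinity> (distr_of_measure \<mu>) \<le> ennreal C * sbe_norm \<alpha> p q \<mu>"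
    if fin: "finite_measure \<mu>" and sets: "sets \<mu> = sets borel" and supp: "emeasure \<mu> (- cball c R) = 0"
    for \<mu> :: "'a measure" and c
  proof -
    have "emeasure \<mu> (- cball c R') \<le> emeasure \<mu> (- cball c R)"
      by (intro emeasure_mono) (auto simp: sets R'_def)
    then have supp': "emeasure \<mu> (- cball c R') = 0" using supp by simp
    show ?thesis unfolding besov_norm_def
    proof (rule Lp_norm_count_space_infinity_le)
      fix j
      show "ennreal (2 powr (real j * \<alpha>)) *
         Lp_norm lborel q (\<lambda>x. ennreal (norm (multiplier (inhom_symbol \<phi> j) (distr_of_measure \<mu>) x)))
         \<le> ennreal C * sbe_norm \<alpha> p q \<mu>"
      proof (cases "j = 0")
        case True
        have "Lp_norm lborel q (\<lambda>x. ennreal (norm (multiplier \<phi> (distr_of_measure \<mu>) x)))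
           \<le> ennreal C3 * (ennreal C2 * sbe_norm \<alpha> p q \<mu>)"
          by (rule order_trans[OF C3(2)[OF fin sets supp'] mult_left_mono[OF C2(2)[OF fin sets supp']]]) simp
        also have "\<dots> \<le> ennreal C * sbe_norm \<alpha> p q \<mu>"
          unfolding mult.assoc[symmetric] by (intro mult_right_mono C) simp
        finally show ?thesis using True by (simp add: inhom_symbol_def)
      next
        case False
        then show ?thesis
          using order_trans[OF C1(2)[OF fin sets, of "int j"] mult_right_mono[OF C(2)]]
          by (simp add: inhom_symbol_def)
      qed
    qed
  qed
  then show ?thesis using C(1) by blast
qed

theorem theorem2p2:
  fixes \<alpha> :: real and p q :: ennreal and \<phi> :: "'a::euclidean_space \<Rightarrow> real"
  assumes "0 < \<alpha>" and "1 \<le> p" and "p < \<infinity>" and "1 \<le> q" and "lp_cutoff \<phi>"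
  shows "(\<forall>\<mu> :: 'a measure. \<mu> \<in> SBE \<alpha> p q \<longrightarrow>
            distr_of_measure \<mu> \<in> besov_space \<phi> \<alpha> q \<infinity>) \<and>
         (\<exists>C :: real. \<forall>\<mu> :: 'a measure. \<mu> \<in> SBE \<alpha> p q \<longrightarrow>
            hom_besov_norm \<phi> \<alpha> q \<infinity> (distr_of_measure \<mu>) \<le> ennreal C * sbe_norm \<alpha> p q \<mu>) \<and>
         (\<forall>R :: real. \<exists>C :: real. \<forall>(\<mu> :: 'a measure) c.
            \<mu> \<in> SBE \<alpha> p q \<longrightarrow> emeasure \<mu> (- cball c R) = 0 \<longrightarrow>
            besov_norm \<phi> \<alpha> q \<infinity> (distr_of_measure \<mu>) \<le> ennreal C * sbe_norm \<alpha> p q \<mu>)"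
proof (intro conjI allI impI)
  have p: "p \<noteq> \<infinity>" using assms(3) by auto
  note block = dyadic_block_bound[OF assms(1,2) p assms(4,5)]
  note inhom = besov_norm_le_sbe_norm[OF assms(1,2) p assms(4,5)]
  have SBE: "finite_measure \<mu>" "sets \<mu> = sets borel" "sbe_norm \<alpha> p q \<mu> < \<infinity>"
    if "\<mu> \<in> SBE \<alpha> p q" for \<mu> :: "'a measure"
    using that by (auto simp: SBE_def compact_finite_measure_def)
  show "\<exists>C :: real. \<forall>(\<mu> :: 'a measure) c.
      \<mu> \<in> SBE \<alpha> p q \<longrightarrow> emeasure \<mu> (- cball c R) = 0 \<longrightarrow>
      besov_norm \<phi> \<alpha> q \<infinity> (distr_of_measure \<mu>) \<le> ennreal C * sbe_norm \<alpha> p q \<mu>" for R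
    using inhom[of R] SBE by meson
  show "\<exists>C :: real. \<forall>\<mu> :: 'a measure. \<mu> \<in> SBE \<alpha> p q \<longrightarrow>
      hom_besov_norm \<phi> \<alpha> q \<infinity> (distr_of_measure \<mu>) \<le> ennreal C * sbe_norm \<alpha> p q \<mu>"
  proof -
    obtain C where C: "\<And>(\<mu> :: 'a measure) j. finite_measure \<mu> \<Longrightarrow> sets \<mu> = sets borel \<Longrightarrow>
      ennreal (2 powr (real_of_int j * \<alpha>)) *
        Lp_norm lborel q (\<lambda>x. ennreal (norm (multiplier (dyadic_symbol \<phi> j) (distr_of_measure \<mu>) x)))
      \<le> ennreal C * sbe_norm \<alpha> p q \<mu>"
      using block by blast
    show ?thesis unfolding hom_besov_norm_def
      by (intro exI[of _ C] allI impI Lp_norm_count_space_infinity_le C SBE)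
  qed
  fix \<mu> :: "'a measure" assume \<mu>: "\<mu> \<in> SBE \<alpha> p q"
  then obtain K where K: "compact K" "emeasure \<mu> (- K) = 0"
    by (auto simp: SBE_def compact_finite_measure_def)
  obtain R where R: "K \<subseteq> cball 0 R"
    using compact_imp_bounded[OF K(1)] unfolding bounded_iff by (auto simp: subset_iff)
  have "emeasure \<mu> (- cball 0 R) \<le> emeasure \<mu> (- K)"
    using R borel_comp[OF borel_closed[OF compact_imp_closed[OF K(1)]]] SBE(2)[OF \<mu>]
    by (intro emeasure_mono) auto
  then have "emeasure \<mu> (- cball 0 R) = 0" using K(2) by simp
  then obtain C where "besov_norm \<phi> \<alpha> q \<infinity> (distr_of_measure \<mu>) \<le> ennreal C * sbe_norm \<alpha> p q \<mu>"
    using inhom[of R] SBE(1,2)[OF \<mu>] by blast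
  also have "\<dots> < \<infinity>" using SBE(3)[OF \<mu>] by (simp add: ennreal_mult_less_top)
  finally show "distr_of_measure \<mu> \<in> besov_space \<phi> \<alpha> q \<infinity>"
    using tempered_distribution_distr_of_measure SBE[OF \<mu>] by (simp add: besov_space_def)
qed

end
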